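(* Let $h_0>0$ or $h_0\in(-1,0)$, and let $w_{h_0}$ be the non-constant stationary solution in $\mathcal H^1$ of (LLG) with $h\equiv h_0$ such that $\lim_{-\infty}w_{h_0}=e_1$ (unique up to translations in space and rotations around $e_1$). (A) If $h_0>0$, then $\lim_{+\infty}w_{h_0}=e_1$ and, up to the invariances, $w_{h_0}$ can be taken with values in $\mathbb S^1\times\{0\}$ and symmetric: $w_{h_0}=(\cos\theta_{h_0},\sin\theta_{h_0},0)$ with $\theta_{h_0}:\mathbb R\to\mathbb R$ smooth and satisfying: - $\theta_{h_0}(0)=\pi$ and $\partial_x\theta_{h_0}(0)=\sqrt{4h_0}$; - $\lim_{-\infty}\theta_{h_0}=0$ and $\lim_{+\infty}\theta_{h_0}=2\pi$; - $\theta_{h_0}-\pi$ is odd; - $\theta=\theta_{h_0}$ solves $-\partial_{xx}\theta+\sin\theta\cos\theta+h_0\sin\theta=0$ and $\partial_x\theta=\sqrt{\sin^2\theta+2h_0(1-\cos\theta)}$ on $\mathbb R$; - $\sin\theta_{h_0}\in L^2$, $1-\cos\theta_{h_0}\in L^1$, and $\partial_x\theta_{h_0}\in H^k$ for any $k\ge1$; - $H(w_{h_0})(x)=\Lambda(x)\,w_{h_0}(x)$ for all $x\in\mathbb R$, where $\Lambda=-2\sin^2\theta_{h_0}+3h_0\cos\theta_{h_0}-2h_0$. (B) If $h_0\in(-1,0)$, then $\lim_{+\infty}w_{h_0}=e_1$ and, up to the invariances, $w_{h_0}$ can be taken with values in $\mathbb S^1\times\{0\}$ and symmetric: $w_{h_0}=(\cos\theta_{h_0},\sin\theta_{h_0},0)$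 with $\theta_{h_0}:\mathbb R\to\mathbb R$ smooth and satisfying: - $\theta_{h_0}(0)=\arccos(-1-2h_0)$ and $\partial_x\theta_{h_0}(0)=0$; - $\lim_{\pm\infty}\theta_{h_0}=0$; - $\theta_{h_0}$ is even; - $\theta=\theta_{h_0}$ solves $-\partial_{xx}\theta+\sin\theta\cos\theta+h_0\sin\theta=0$ and $\partial_x\theta=-\operatorname{sgn}(x)\sqrt{\sin^2\theta+2h_0(1-\cos\theta)}$ on $\mathbb R$; - $\sin\theta_{h_0}\in L^2$, $1-\cos\theta_{h_0}\in L^1$, and $\partial_x\theta_{h_0}\in H^k$ for any $k\ge1$; - $H(w_{h_0})(x)=\Lambda(x)\,w_{h_0}(x)$ for all $x\in\mathbb R$, where $\Lambda=-2\sin^2\theta_{h_0}+3h_0\cos\theta_{h_0}-2h_0$.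
   Context: $e_1,e_2,e_3$ is the canonical basis of $\mathbb R^3$, $\wedge$ the cross product, $\mathbb S^2$ (resp. $\mathbb S^1$) the unit sphere of $\mathbb R^3$ (resp. $\mathbb R^2$). Let $\alpha>0$. The Landau-Lifshitz-Gilbert equation (LLG) with constant external field $h\equiv h_0$, for $m=(m_1,m_2,m_3)$ with values in $\mathbb S^2$, is $$\partial_t m=m\wedge H(m)-\alpha\, m\wedge(m\wedge H(m)),\qquad H(m)=\partial_{xx}m-m_2e_2-m_3e_3+h_0e_1 .$$ $\mathcal H^1$ is the set of $m\in\mathscr C(\mathbb R,\mathbb S^2)$ with $\|m_2\|_{L^2}+\|m_3\|_{L^2}+\|\partial_x m\|_{L^2}<\infty$. A stationary solution $w\in\mathcal H^1$ is a time-independent solution, i.e. $w\wedge H(w)=0$ in the sense of distributions. The invariances are the maps $w\mapsto R_\phi w(\cdot-y)$, $y\in\mathbb R$, $\phi\in\mathbb R/2\pi\mathbb Z$, where $R_\phi$ is the rotation of angle $\phi$ around $e_1$. For $h_0>0$ or $h_0\in(-1,0)$ it is known that a non-constant stationary solution in $\mathcal H^1$ with limit $e_1$ at $-\infty$ exists and is unique up to these invariances; it is denoted $w_{h_0}$ (a representative being chosen as in the statement). The word "symmetric" refers to the parity properties of $\theta_{h_0}$ listed. *)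

theory Defs
  imports "HOL-Analysis.Analysis"
begin

unbundle cross3_syntax

abbreviation e1 :: "real^3" where "e1 \<equiv> axis 1 1"
abbreviation e2 :: "real^3" where "e2 \<equiv> axis 2 1"
abbreviation e3 :: "real^3" where "e3 \<equiv> axis 3 1"

definition smooth :: "(real \<Rightarrow> real) \<Rightarrow> bool" where
  "smooth f \<longleftrightarrow> (\<forall>n. (deriv ^^ n) f differentiable_on UNIV)"

definition test_function :: "(real \<Rightarrow> real) \<Rightarrow> bool" where
  "test_function \<phi> \<longleftrightarrow> smooth \<phi> \<and> compact (closure {x. \<phi> x \<noteq> 0})"

definition locally_integrable :: "(real \<Rightarrow> 'a::euclidean_space) \<Rightarrow> bool" where
  "locally_integrable f \<longleftrightarrow> (\<forall>K. compact K \<longrightarrow> f absolutely_integrable_on K)"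

definition has_weak_derivative ::
    "(real \<Rightarrow> 'a::euclidean_space) \<Rightarrow> (real \<Rightarrow> 'a) \<Rightarrow> bool" where
  "has_weak_derivative f g \<longleftrightarrow>
     locally_integrable f \<and> locally_integrable g \<and>
     (\<forall>\<phi>. test_function \<phi> \<longrightarrow>
        (LINT x|lebesgue. deriv \<phi> x *\<^sub>R f x) = - (LINT x|lebesgue. \<phi> x *\<^sub>R g x))"

definition square_integrable :: "(real \<Rightarrow> 'a::euclidean_space) \<Rightarrow> bool" where
  "square_integrable f \<longleftrightarrow>
     f \<in> borel_measurable lebesgue \<and> integrable lebesgue (\<lambda>x. (norm (f x))\<^sup>2)"

text \<open>The Sobolev space $H^k$ on the real line, through weak derivatives.\<close>

fun sobolev :: "nat \<Rightarrow> (real \<Rightarrow> real) \<Rightarrow> bool" where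
  "sobolev 0 f \<longleftrightarrow> square_integrable f"
| "sobolev (Suc k) f \<longleftrightarrow>
     square_integrable f \<and> (\<exists>g. has_weak_derivative f g \<and> sobolev k g)"

definition energy_space :: "(real \<Rightarrow> real^3) set" where
  "energy_space = {m. continuous_on UNIV m \<and> range m \<subseteq> sphere 0 1 \<and>
     square_integrable (\<lambda>x. m x $ 2) \<and> square_integrable (\<lambda>x. m x $ 3) \<and>
     (\<exists>g. has_weak_derivative m g \<and> square_integrable g)}"

definition lower_order :: "real \<Rightarrow> real^3 \<Rightarrow> real^3" where
  "lower_order h v = h *\<^sub>R e1 - (v $ 2) *\<^sub>R e2 - (v $ 3) *\<^sub>R e3"

text \<open>The effective field $H(m)$, with classical derivatives.\<close>

definition eff_field :: "real \<Rightarrow> (real \<Rightarrow> real^3) \<Rightarrow> real \<Rightarrow> real^3" where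
  "eff_field h m x =
     vector_derivative (\<lambda>y. vector_derivative m (at y)) (at x) + lower_order h (m x)"

text \<open>
  The equation $w \wedge H(w) = 0$ in the sense of distributions, for $w$ in the energy space.
  With $g = \partial_x w$ in $L^2$, the product of $w$ and the distribution $\partial_x g$ is
  defined by transposition,
  $\langle w \wedge \partial_x g, \phi\rangle = - \int \partial_x(\phi w) \wedge g
   = - \int (\phi' w + \phi g) \wedge g$.
  As $g$ is unique up to a null set, its choice does not matter.
\<close>

definition stationary_solution :: "real \<Rightarrow> (real \<Rightarrow> real^3) \<Rightarrow> bool" where
  "stationary_solution h w \<longleftrightarrow> w \<in> energy_space \<and>
     (\<exists>g. has_weak_derivative w g \<and> square_integrable g \<and>
       (\<forall>\<phi>. test_function \<phi> \<longrightarrow>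
          - (LINT x|lebesgue. (deriv \<phi> x *\<^sub>R w x + \<phi> x *\<^sub>R g x) \<times> g x)
          + (LINT x|lebesgue. \<phi> x *\<^sub>R (w x \<times> lower_order h (w x))) = 0))"

text \<open>The characterization of $w_{h_0}$, which determines it up to the invariances.\<close>

definition nontrivial_stationary :: "real \<Rightarrow> (real \<Rightarrow> real^3) \<Rightarrow> bool" where
  "nontrivial_stationary h w \<longleftrightarrow>
     stationary_solution h w \<and> \<not> w constant_on UNIV \<and> (w \<longlongrightarrow> e1) at_bot"

definition rotation_e1 :: "real \<Rightarrow> real^3 \<Rightarrow> real^3" where
  "rotation_e1 \<phi> v =
     vector [v $ 1, cos \<phi> * v $ 2 - sin \<phi> * v $ 3, sin \<phi> * v $ 2 + cos \<phi> * v $ 3]"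

definition act :: "real \<Rightarrow> real \<Rightarrow> (real \<Rightarrow> real^3) \<Rightarrow> real \<Rightarrow> real^3" where
  "act \<phi> y w = (\<lambda>x. rotation_e1 \<phi> (w (x - y)))"

definition planar :: "(real \<Rightarrow> real) \<Rightarrow> real \<Rightarrow> real^3" where
  "planar \<theta> = (\<lambda>x. vector [cos (\<theta> x), sin (\<theta> x), 0])"

end

theory Submission
  imports Defs
begin

text \<open>
  Let \<open>v\<close> be a weak derivative of a stationary solution \<open>w\<close>. The equation says that \<open>V = w \<times> v\<close> has
  the continuous weak derivative \<open>L(w) \<times> w\<close>, where \<open>L\<close> is the zeroth-order part of \<open>H\<close>. Since
  \<open>w \<bullet> v = 0\<close> almost everywhere, \<open>v = V \<times> w\<close>, so \<open>(w, V)\<close> is a classical solution of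
  \<open>w' = V \<times> w\<close>, \<open>V' = L(w) \<times> w\<close>. The first component of \<open>V\<close> and
  \<open>|V|\<^sup>2 + 2 h w\<^sub>1 - w\<^sub>2\<^sup>2 - w\<^sub>3\<^sup>2\<close> are conserved, and as \<open>V\<close> is square integrable and \<open>w\<close> tends to \<open>e\<^sub>1\<close>
  at \<open>-\<infinity>\<close>, they equal \<open>0\<close> and \<open>2 h\<close>.

  With \<open>\<theta> = \<pi> + 2 arctan g\<close>, the equation for \<open>\<theta>\<close> becomes \<open>g'' = (1 + h) g\<close>, \<open>g'\<^sup>2 = (1 + h) g\<^sup>2 + h\<close>,
  so \<open>g\<close> is a multiple of \<open>sinh(\<surd>(1 + h) x)\<close> if \<open>h > 0\<close> and of \<open>cosh(\<surd>(1 + h) x)\<close> if \<open>h < 0\<close>. At a point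
  where \<open>w \<noteq> e\<^sub>1\<close>, the two conserved quantities force \<open>(w, V)\<close> to agree with the data of a rotated
  translate of this explicit profile, and uniqueness for the ODE identifies \<open>w\<close> with it.
\<close>

subsection \<open>Smooth functions\<close>

text \<open>The state \<open>(w, V)\<close> has four degrees of freedom: a point of the sphere and a
  tangent vector. The two conserved values cut out a surface, and translations and rotations have
  two parameters as well; away from the rest point \<open>(e1, 0)\<close> the surface is a single
  orbit. Hence neither a global lift of \<open>w\<close> to an angle nor a prior proof of planarity
  enters.

  The variable g is -cot(\<theta>/2), the stereographic coordinate seen from \<open>e1\<close>. It
  blows up only at \<open>e1\<close>, which the profile approaches but never reaches, and on this
  energy level it makes the equation linear: limits, decay and symmetry become facts about sinh and
  cosh.

  The delicate point is the start. In the energy space v is only an L^2 class, and the equation is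
  tested against smooth functions of compact support. V is the right unknown because in the tested
  product (\<phi>' w + \<phi> v) \<times> v the quadratic term v \<times> v drops out, which leaves
  the definition of a weak derivative of V. Making it classical requires smooth cutoffs and a
  fundamental theorem of calculus for weak derivatives.\<close>

primrec derivs_hold :: "((real \<Rightarrow> real) \<Rightarrow> bool) \<Rightarrow> nat \<Rightarrow> (real \<Rightarrow> real) \<Rightarrow> bool" where
  "derivs_hold P 0 f \<longleftrightarrow> P f \<and> f differentiable_on UNIV"
| "derivs_hold P (Suc n) f \<longleftrightarrow> P f \<and> f differentiable_on UNIV \<and> derivs_hold P n (deriv f)"

lemma differentiable_on_UNIV_DERIV:
  fixes f :: "real \<Rightarrow> real"
  shows "f differentiable_on UNIV \<longleftrightarrow> (\<forall>x. DERIV f x :> deriv f x)"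
  by (simp add: differentiable_on_def DERIV_deriv_iff_real_differentiable)

lemma derivs_hold_DERIV: "derivs_hold P n f \<Longrightarrow> DERIV f x :> deriv f x"
  by (cases n) (simp_all add: differentiable_on_UNIV_DERIV)

text \<open>The predicate \<open>P\<close> is carried through all derivatives up to order
  \<open>n\<close>, so one induction scheme serves smoothness (\<open>P\<close> trivial),
  boundedness and square integrability. An explicit \<open>f'\<close> in place of
  \<open>deriv f\<close> lets these inductions run on differentiation formulas that close
  up.\<close>

lemma derivs_hold_Suc_iff:
  assumes "\<And>x. DERIV f x :> f' x"
  shows "derivs_hold P (Suc n) f \<longleftrightarrow> P f \<and> derivs_hold P n f'"
proof -
  have "deriv f = f'"
    using assms by (blast intro: DERIV_imp_deriv)
  moreover have "f differentiable_on UNIV"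
    using assms by (auto simp: differentiable_on_UNIV_DERIV \<open>deriv f = f'\<close>)
  ultimately show ?thesis by simp
qed

lemma derivs_hold_0I: "P f \<Longrightarrow> (\<And>x. DERIV f x :> f' x) \<Longrightarrow> derivs_hold P 0 f"
  by (auto simp: differentiable_on_UNIV_DERIV) (metis DERIV_imp_deriv)

lemma derivs_hold_Suc_imp: "derivs_hold P (Suc n) f \<Longrightarrow> derivs_hold P n f"
  by (induction n arbitrary: f) auto

lemma smooth_iff: "smooth f \<longleftrightarrow> (\<forall>n. derivs_hold (\<lambda>_. True) n f)"
proof -
  have "derivs_hold (\<lambda>_. True) n f \<longleftrightarrow> (\<forall>k\<le>n. (deriv ^^ k) f differentiable_on UNIV)" for n f
  proof (induction n arbitrary: f)
    case (Suc n)
    have "(\<forall>k\<le>Suc n. Q k) \<longleftrightarrow> Q 0 \<and> (\<forall>k\<le>n. Q (Suc k))" for Q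
      by (metis Suc_le_mono bot_nat_0.extremum nat.exhaust)
    from this[of "\<lambda>k. (deriv ^^ k) f differentiable_on UNIV"]
    have "(\<forall>k\<le>Suc n. (deriv ^^ k) f differentiable_on UNIV) \<longleftrightarrow>
        f differentiable_on UNIV \<and> (\<forall>k\<le>n. (deriv ^^ k) (deriv f) differentiable_on UNIV)"
      by (simp add: funpow_Suc_right del: funpow.simps(2))
    then show ?case using Suc by simp
  qed simp
  then show ?thesis by (auto simp: smooth_def)
qed

lemma smoothI:
  assumes "\<And>x. DERIV f x :> f' x" "smooth f'"
  shows "smooth f"
  unfolding smooth_iff
proof
  show "derivs_hold (\<lambda>_. True) n f" for n
    using assms derivs_hold_Suc_iff[OF assms(1)] derivs_hold_Suc_imp unfolding smooth_iff by blast
qed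

lemma smooth_DERIV: "smooth f \<Longrightarrow> DERIV f x :> deriv f x"
  using derivs_hold_DERIV smooth_iff by blast

lemma smooth_deriv: "smooth f \<Longrightarrow> smooth (deriv f)"
  unfolding smooth_iff by (metis derivs_hold.simps(2))

lemma smooth_continuous_on: "smooth f \<Longrightarrow> continuous_on S f"
  by (rule DERIV_continuous_on[OF has_field_derivative_at_within[OF smooth_DERIV]])

lemma derivs_hold_const:
  assumes "\<And>c. P (\<lambda>_. c)"
  shows "derivs_hold P n (\<lambda>_. c)"
proof (induction n arbitrary: c)
  case (Suc n)
  then show ?case by (subst derivs_hold_Suc_iff[where f' = "\<lambda>_. 0"]) (auto simp: assms)
qed (auto simp: assms)

lemma derivs_hold_add:
  assumes "\<And>f g. P f \<Longrightarrow> P g \<Longrightarrow> P (\<lambda>x. f x + g x)"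
  shows "derivs_hold P n f \<Longrightarrow> derivs_hold P n g \<Longrightarrow> derivs_hold P n (\<lambda>x. f x + g x)"
proof (induction n arbitrary: f g)
  case (Suc n)
  have "DERIV (\<lambda>x. f x + g x) x :> deriv f x + deriv g x" for x
    by (intro DERIV_add derivs_hold_DERIV[OF Suc.prems(1)] derivs_hold_DERIV[OF Suc.prems(2)])
  then show ?case
    using Suc assms by (subst derivs_hold_Suc_iff) auto
qed (auto simp: assms)

text \<open>The Leibniz rule only needs \<open>Q\<close> to be stable under sums and under
  multiplication by functions satisfying \<open>P\<close>. Two predicates are used because
  square-integrable functions are not closed under products but are closed under bounded
  factors.\<close>

lemma derivs_hold_mult:
  assumes add: "\<And>f g. Q f \<Longrightarrow> Q g \<Longrightarrow> Q (\<lambda>x. f x + g x)"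
    and mult: "\<And>f g. P f \<Longrightarrow> Q g \<Longrightarrow> Q (\<lambda>x. f x * g x)"
  shows "derivs_hold P n f \<Longrightarrow> derivs_hold Q n g \<Longrightarrow> derivs_hold Q n (\<lambda>x. f x * g x)"
proof (induction n arbitrary: f g)
  case (Suc n)
  have "DERIV (\<lambda>x. f x * g x) x :> deriv f x * g x + f x * deriv g x" for x
    using derivs_hold_DERIV[OF Suc.prems(1)] derivs_hold_DERIV[OF Suc.prems(2)]
    by (auto intro!: derivative_eq_intros)
  then show ?case
    using Suc assms
    by (subst derivs_hold_Suc_iff)
      (auto intro!: derivs_hold_add Suc.IH intro: derivs_hold_Suc_imp[of _ n, unfolded derivs_hold.simps(2)])
qed (auto simp: assms)

lemma smooth_const: "smooth (\<lambda>_. c)"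
  by (simp add: smooth_iff derivs_hold_const)

lemma smooth_id: "smooth (\<lambda>x. x)"
  by (rule smoothI[OF DERIV_ident smooth_const])

lemma smooth_add: "smooth f \<Longrightarrow> smooth g \<Longrightarrow> smooth (\<lambda>x. f x + g x)"
  unfolding smooth_iff by (blast intro: derivs_hold_add)

lemma smooth_mult: "smooth f \<Longrightarrow> smooth g \<Longrightarrow> smooth (\<lambda>x. f x * g x)"
  unfolding smooth_iff by (blast intro: derivs_hold_mult)

lemma smooth_diff: "smooth f \<Longrightarrow> smooth g \<Longrightarrow> smooth (\<lambda>x. f x - g x)"
  using smooth_add[OF _ smooth_mult[OF smooth_const[of "-1"]], of f g] by simp

lemma smooth_compose:
  assumes "smooth f" "smooth g"
  shows "smooth (\<lambda>x. f (g x))"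
proof -
  have "derivs_hold (\<lambda>_. True) n (\<lambda>x. f (g x))" if "smooth f" for n f
    using that
  proof (induction n arbitrary: f)
    case 0
    show ?case
      by (rule derivs_hold_0I[OF TrueI DERIV_chain2[OF smooth_DERIV[OF 0] smooth_DERIV[OF assms(2)]]])
  next
    case (Suc n)
    have "derivs_hold (\<lambda>_. True) n (\<lambda>x. deriv f (g x) * deriv g x)"
      using Suc.IH[OF smooth_deriv[OF Suc.prems]] smooth_deriv[OF assms(2)]
      by (intro derivs_hold_mult) (auto simp: smooth_iff)
    moreover have "DERIV (\<lambda>x. f (g x)) x :> deriv f (g x) * deriv g x" for x
      using smooth_DERIV[OF Suc.prems] smooth_DERIV[OF assms(2)] by (intro DERIV_chain2)
    ultimately show ?case by (subst derivs_hold_Suc_iff) auto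
  qed
  with assms show ?thesis unfolding smooth_iff by blast
qed

lemma smooth_inverse:
  assumes "smooth f" "\<And>x. f x \<noteq> 0"
  shows "smooth (\<lambda>x. inverse (f x))"
proof -
  \<comment> \<open>The derivative is written with factors \<open>inverse (f x)\<close>, so that the
    induction hypothesis about \<open>inverse f\<close> applies to it.\<close>
  have D: "DERIV (\<lambda>x. inverse (f x)) x :> (- 1 * deriv f x) * (inverse (f x) * inverse (f x))" for x
    using smooth_DERIV[OF assms(1)] assms(2)[of x]
    by (auto intro!: derivative_eq_intros)
  have "derivs_hold (\<lambda>_. True) n (\<lambda>x. inverse (f x))" for n
  proof (induction n)
    case 0
    show ?case by (rule derivs_hold_0I[OF _ D]) auto
  next
    case (Suc n)
    have "derivs_hold (\<lambda>_. True) n (\<lambda>x. - 1 * deriv f x)" (is "derivs_hold _ _ ?f'")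
      using smooth_mult[OF smooth_const smooth_deriv[OF assms(1)]] unfolding smooth_iff by blast
    then show ?case
      unfolding derivs_hold_Suc_iff[OF D]
      by (intro conjI derivs_hold_mult[of _ _ n ?f'] derivs_hold_mult[OF _ _ Suc Suc]) auto
  qed
  then show ?thesis by (simp add: smooth_iff)
qed

section \<open>A smooth step and its primitive\<close>

definition poly_exp_inverse :: "real poly \<Rightarrow> real \<Rightarrow> real" where
  "poly_exp_inverse p x = (if x > 0 then poly p (1 / x) * exp (- 1 / x) else 0)"

lemma poly_times_exp_minus_tendsto_0: "((\<lambda>y::real. poly p y * exp (- y)) \<longlongrightarrow> 0) at_top"
proof -
  have "((\<lambda>y::real. \<Sum>i\<le>degree p. coeff p i * (y ^ i / exp y)) \<longlongrightarrow> (\<Sum>i\<le>degree p. coeff p i * 0)) at_top"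
    by (intro tendsto_intros tendsto_power_div_exp_0)
  then show ?thesis
    by (simp add: poly_altdef sum_distrib_right exp_minus divide_inverse mult.assoc)
qed

text \<open>The polynomial factor is there to make the family closed under differentiation. With y =
  1/x and dy/dx = -y^2, the function p(y) exp(-y) has derivative y^2 (p(y) - p'(y)) exp(-y), and
  \<open>[:0, 0, 1:]\<close> is y^2. At 0 the right difference quotient is y p(y) exp(-y), which
  tends to 0 as y grows.\<close>

lemma DERIV_poly_exp_inverse:
  "DERIV (poly_exp_inverse p) x :> poly_exp_inverse ([:0, 0, 1:] * (p - pderiv p)) x"
proof -
  consider "x > 0" | "x < 0" | "x = 0" by linarith
  then show ?thesis
  proof cases
    case 1
    have "((\<lambda>x. poly p (1 / x) * exp (- 1 / x)) has_real_derivative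
        poly_exp_inverse ([:0, 0, 1:] * (p - pderiv p)) x) (at x)"
      using 1 by (auto intro!: derivative_eq_intros simp: poly_exp_inverse_def field_simps power2_eq_square)
    moreover have "\<forall>\<^sub>F y in nhds x. poly_exp_inverse p y = poly p (1 / y) * exp (- 1 / y)"
      using eventually_nhds_in_open[of "{0<..}" x] 1
      by (auto elim!: eventually_mono simp: poly_exp_inverse_def)
    ultimately show ?thesis by (subst DERIV_cong_ev[OF refl _ refl])
  next
    case 2
    have "\<forall>\<^sub>F y in nhds x. poly_exp_inverse p y = 0"
      using eventually_nhds_in_open[of "{..<0}" x] 2
      by (auto elim!: eventually_mono simp: poly_exp_inverse_def)
    then have "DERIV (poly_exp_inverse p) x :> 0"
      by (subst DERIV_cong_ev[OF refl _ refl, where g = "\<lambda>_. 0"]) auto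
    then show ?thesis using 2 by (simp add: poly_exp_inverse_def)
  next
    case 3
    have "((\<lambda>h. poly ([:0, 1:] * p) (inverse h) * exp (- inverse h)) \<longlongrightarrow> 0) (at_right 0)"
      by (rule filterlim_compose[OF poly_times_exp_minus_tendsto_0 filterlim_inverse_at_top_right])
    then have "((\<lambda>h. poly_exp_inverse p h / h) \<longlongrightarrow> 0) (at_right 0)"
      by (rule Lim_transform_eventually)
        (auto simp: eventually_at_right_field poly_exp_inverse_def divide_inverse intro!: exI[of _ 1])
    moreover have "((\<lambda>h. poly_exp_inverse p h / h) \<longlongrightarrow> 0) (at_left 0)"
      by (rule Lim_transform_eventually[OF tendsto_const])
        (auto simp: eventually_at_left_field poly_exp_inverse_def intro!: exI[of _ "-1"])
    ultimately have "((\<lambda>h. poly_exp_inverse p h / h) \<longlongrightarrow> 0) (at 0)"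
      by (simp add: filterlim_split_at)
    then show ?thesis
      by (simp add: 3 DERIV_def poly_exp_inverse_def)
  qed
qed

lemma smooth_poly_exp_inverse: "smooth (poly_exp_inverse p)"
proof -
  have "derivs_hold (\<lambda>_. True) n (poly_exp_inverse p)" for n
  proof (induction n arbitrary: p)
    case 0
    show ?case by (rule derivs_hold_0I[OF _ DERIV_poly_exp_inverse]) simp
  next
    case (Suc n)
    show ?case using Suc.IH by (subst derivs_hold_Suc_iff[OF DERIV_poly_exp_inverse]) auto
  qed
  then show ?thesis by (simp add: smooth_iff)
qed

text \<open>The quotient is defined everywhere because x > 0 or 1 - x > 0 always holds, so one of
  the two flat functions in the denominator is positive.\<close>

definition smooth_step :: "real \<Rightarrow> real" where
  "smooth_step x = poly_exp_inverse 1 x * inverse (poly_exp_inverse 1 x + poly_exp_inverse 1 (1 - x))"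

lemma smooth_step_denominator_pos: "poly_exp_inverse 1 x + poly_exp_inverse 1 (1 - x) > 0"
  by (auto simp: poly_exp_inverse_def add_pos_pos)

lemma smooth_smooth_step: "smooth smooth_step"
  unfolding smooth_step_def[abs_def]
  by (intro smooth_mult smooth_inverse smooth_add smooth_compose[OF smooth_poly_exp_inverse]
      smooth_diff smooth_const smooth_id smooth_poly_exp_inverse)
    (use smooth_step_denominator_pos in \<open>simp add: less_imp_neq[symmetric]\<close>)

lemma smooth_step_eq_0: "x \<le> 0 \<Longrightarrow> smooth_step x = 0"
  by (simp add: smooth_step_def poly_exp_inverse_def)

lemma smooth_step_eq_1: "x \<ge> 1 \<Longrightarrow> smooth_step x = 1"
  by (simp add: smooth_step_def poly_exp_inverse_def)

lemma smooth_step_bounds: "0 \<le> smooth_step x" "smooth_step x \<le> 1"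
proof -
  have "0 \<le> poly_exp_inverse 1 y" for y by (simp add: poly_exp_inverse_def)
  with smooth_step_denominator_pos[of x] show "0 \<le> smooth_step x" "smooth_step x \<le> 1"
    by (simp_all add: smooth_step_def divide_inverse[symmetric])
qed

text \<open>\<open>U\<close> is the primitive of the step that vanishes at 0. Its slope lies in
  [0, 1], so U increases while U - x decreases, which traps it near \<open>max 0 x\<close>. The
  uniform error 1 becomes 1/m after rescaling to U(m x)/m.\<close>

lemma smooth_ramp_exists:
  obtains U where "smooth U" "\<And>x. DERIV U x :> smooth_step x"
    "\<And>x. x \<le> 0 \<Longrightarrow> U x = 0" "\<And>x. x \<ge> 1 \<Longrightarrow> U x = x - 1 + U 1"
    "\<And>x. \<bar>U x - max 0 x\<bar> \<le> 1"
proof -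
  have "isCont smooth_step x" for x
    by (rule DERIV_isCont[OF smooth_DERIV[OF smooth_smooth_step]])
  then obtain F where F: "\<And>x. (F has_vector_derivative smooth_step x) (at x)"
    using einterval_antiderivative[of "-\<infinity>" \<infinity> smooth_step] by auto
  define U where "U x = F x - F 0" for x
  have D: "DERIV U x :> smooth_step x" for x
    using F[of x] unfolding U_def has_real_derivative_iff_has_vector_derivative[symmetric]
    by (auto intro!: derivative_eq_intros)
  have U0: "U 0 = 0" by (simp add: U_def)
  have left: "U x = 0" if "x \<le> 0" for x
  proof (cases "x = 0")
    case False
    have "U 0 = U x"
    proof (rule DERIV_isconst_end[of x 0 U])
      show "continuous_on {x..0} U"
        by (rule DERIV_continuous_on[OF has_field_derivative_at_within[OF D]])
      show "DERIV U y :> 0" if "y < 0" for y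
        using D[of y] smooth_step_eq_0[of y] that by simp
    qed (use that False in auto)
    then show ?thesis using U0 by simp
  qed (simp add: U0)
  have right: "U x = x - 1 + U 1" if "x \<ge> 1" for x
  proof (cases "x = 1")
    case False
    have D': "DERIV (\<lambda>x. U x - x) y :> smooth_step y - 1" for y
      using D[of y] by (auto intro!: derivative_eq_intros)
    have "U x - x = U 1 - 1"
    proof (rule DERIV_isconst_end[of 1 x "\<lambda>x. U x - x"])
      show "continuous_on {1..x} (\<lambda>x. U x - x)"
        by (rule DERIV_continuous_on[OF has_field_derivative_at_within[OF D']])
      show "DERIV (\<lambda>x. U x - x) y :> 0" if "1 < y" for y
        using D'[of y] smooth_step_eq_1[of y] that by simp
    qed (use that False in auto)
    then show ?thesis by simp
  qed simp
  have mono: "U x \<le> U y" if "x \<le> y" for x y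
    using that D smooth_step_bounds(1) by (meson DERIV_nonneg_imp_nondecreasing)
  have mono': "U y - y \<le> U x - x" if "x \<le> y" for x y
  proof (rule DERIV_nonpos_imp_nonincreasing[OF that])
    show "\<exists>z. DERIV (\<lambda>x. U x - x) x :> z \<and> z \<le> 0" for x
      using D[of x] smooth_step_bounds(2)[of x]
      by (intro exI[of _ "smooth_step x - 1"]) (auto intro!: derivative_eq_intros)
  qed
  have "\<bar>U x - max 0 x\<bar> \<le> 1" for x
  proof -
    consider "x \<le> 0" | "0 \<le> x" "x \<le> 1" | "1 \<le> x" by linarith
    then show ?thesis
    proof cases
      case 1
      then show ?thesis using left by simp
    next
      case 2
      then show ?thesis using mono[of 0 x] mono'[of 0 x] U0 by simp
    next
      case 3
      then show ?thesis using mono[of 0 1] mono'[of 0 1] right[of x] U0 by simp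
    qed
  qed
  then show ?thesis
    using that[of U] D left right smoothI[OF D smooth_smooth_step] by blast
qed

subsection \<open>Weak derivatives\<close>

lemma continuous_imp_measurable_lebesgue:
  "continuous_on UNIV f \<Longrightarrow> f \<in> borel_measurable lebesgue"
  for f :: "real \<Rightarrow> 'a::euclidean_space"
  by (intro measurable_completion) (simp add: borel_measurable_continuous_onI)

lemma integrable_scaleR_bounded:
  fixes F :: "real \<Rightarrow> 'a::euclidean_space"
  assumes "\<phi> \<in> borel_measurable lebesgue" "\<And>x. \<bar>\<phi> x\<bar> \<le> B" "integrable lebesgue F"
  shows "integrable lebesgue (\<lambda>x. \<phi> x *\<^sub>R F x)"
proof (rule Bochner_Integration.integrable_bound[of _ "\<lambda>x. B * norm (F x)"])
  show "AE x in lebesgue. norm (\<phi> x *\<^sub>R F x) \<le> norm (B * norm (F x))"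
    using assms(2) by (intro AE_I2) (auto simp: abs_mult intro!: mult_right_mono order_trans[OF _ abs_ge_self])
qed (use assms in \<open>auto intro!: borel_measurable_scaleR\<close>)

lemma measurable_continuous_scaleR:
  fixes F :: "real \<Rightarrow> 'a::euclidean_space"
  assumes "continuous_on UNIV \<phi>" "integrable lebesgue F"
  shows "(\<lambda>x. \<phi> x *\<^sub>R F x) \<in> borel_measurable lebesgue"
  using continuous_imp_measurable_lebesgue[OF assms(1)] assms(2) by (intro borel_measurable_scaleR) auto

lemma locally_integrable_indicator:
  "locally_integrable f \<Longrightarrow> integrable lebesgue (\<lambda>x. indicator {a..b} x *\<^sub>R f x)"
  by (simp add: locally_integrable_def set_integrable_def)

lemma locally_integrable_integrable_on: "locally_integrable f \<Longrightarrow> f integrable_on {a..b}"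
  by (simp add: locally_integrable_def set_lebesgue_integral_eq_integral(1))

lemma filterlim_real_Suc_at_top: "filterlim (\<lambda>n. real (Suc n)) at_top sequentially"
  by (rule filterlim_compose[OF filterlim_real_sequentially filterlim_Suc])

text \<open>Half-open intervals arise because \<open>smooth_step\<close> vanishes at 0: the rescaled
  steps tend to the indicator of \<open>{0<..}\<close>. The missing left end is a null set.\<close>

lemma LINT_half_open:
  fixes f :: "real \<Rightarrow> 'a::euclidean_space"
  assumes "locally_integrable f"
  shows "(LINT x|lebesgue. indicator {a<..b} x *\<^sub>R f x) = integral {a..b} f"
proof -
  have "f absolutely_integrable_on {a..b}"
    using assms by (simp add: locally_integrable_def)
  then have "f absolutely_integrable_on {a<..b}"
    by (rule set_integrable_subset) auto
  then have "(LINT x|lebesgue. indicator {a<..b} x *\<^sub>R f x) = integral {a<..b} f"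
    using set_lebesgue_integral_eq_integral(2) unfolding set_lebesgue_integral_def by blast
  also have "\<dots> = integral {a..b} f"
    by (rule integral_spike_set) (auto intro!: negligible_subset[OF negligible_sing[of a]])
  finally show ?thesis .
qed

text \<open>The test functions are second differences of \<open>U(m x) / m\<close>, where \<open>U\<close> is a smooth ramp; they converge
  to the same differences of \<open>max 0 x\<close>, and their derivatives to differences of indicators.\<close>

lemma weak_derivative_second_difference:
  fixes f g :: "real \<Rightarrow> 'a::euclidean_space"
  assumes weak: "has_weak_derivative f g" and "a \<le> b" "h > 0"
  shows "integral {a..a+h} f - integral {b..b+h} f =
    - (LINT x|lebesgue. (max 0 (x - a) - max 0 (x - a - h) - max 0 (x - b) + max 0 (x - b - h)) *\<^sub>R g x)"
proof -
  obtain U where U: "smooth U" "\<And>x. DERIV U x :> smooth_step x"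
    "\<And>x. x \<le> 0 \<Longrightarrow> U x = 0" "\<And>x. x \<ge> 1 \<Longrightarrow> U x = x - 1 + U 1"
    "\<And>x. \<bar>U x - max 0 x\<bar> \<le> 1"
    by (rule smooth_ramp_exists) blast
  define T where "T x = max 0 (x - a) - max 0 (x - a - h) - max 0 (x - b) + max 0 (x - b - h)" for x :: real
  \<comment> \<open>Since \<open>m n\<close> is at least 1, all four ramps are affine beyond b + h +
    1, where the signs +, -, -, + cancel slopes and constants. So this interval contains the
    supports for every \<open>n\<close>, and \<open>f\<close>, \<open>g\<close> may be cut off to
    integrable functions.\<close>
  define K where "K = {a..b + h + 1}"
  define F where "F x = indicator K x *\<^sub>R f x" for x
  define G where "G x = indicator K x *\<^sub>R g x" for x
  define m where "m n = real (Suc n)" for n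
  define \<phi> where "\<phi> n x = inverse (m n) * (U (m n * (x - a)) - U (m n * (x - a - h))
    - U (m n * (x - b)) + U (m n * (x - b - h)))" for n x
  define \<phi>' where "\<phi>' n x = smooth_step (m n * (x - a)) - smooth_step (m n * (x - a - h))
    - smooth_step (m n * (x - b)) + smooth_step (m n * (x - b - h))" for n x
  define J where "J x = (indicator {a<..a+h} x - indicator {b<..b+h} x :: real)" for x
  have m: "m n \<ge> 1" for n by (simp add: m_def)
  have m0: "m n > 0" for n by (simp add: m_def)
  have mge: "1 \<le> m n * y" if "1 \<le> y" for y n
    using mult_mono[OF m[of n] that] m0[of n] by simp
  have mle: "m n * y \<le> 0" if "y \<le> 0" for y n
    using m0[of n] that by (simp add: mult_nonneg_nonpos)
  have mlim: "filterlim m at_top sequentially"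
    unfolding m_def[abs_def] by (rule filterlim_real_Suc_at_top)
  have li: "locally_integrable f" "locally_integrable g"
    using weak by (auto simp: has_weak_derivative_def)
  then have int: "integrable lebesgue F" "integrable lebesgue G"
    unfolding F_def G_def K_def by (auto intro: locally_integrable_indicator)
  have smooth: "smooth (\<phi> n)" for n
    unfolding \<phi>_def[abs_def]
    by (intro smooth_mult smooth_add smooth_diff smooth_compose[OF U(1)] smooth_const smooth_id)
  have "DERIV (\<phi> n) x :> inverse (m n) * (smooth_step (m n * (x - a)) * m n - smooth_step (m n * (x - a - h)) * m n
    - smooth_step (m n * (x - b)) * m n + smooth_step (m n * (x - b - h)) * m n)" for n x
    unfolding \<phi>_def[abs_def]
    by (rule derivative_eq_intros DERIV_chain2[OF U(2)] refl | simp)+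
  moreover have "inverse (m n) * (p * m n - q * m n - r * m n + s * m n) = p - q - r + s" for n p q r s
    using m0[of n] by (simp add: field_simps)
  ultimately have D: "deriv (\<phi> n) = \<phi>' n" for n
    by (intro ext DERIV_imp_deriv) (simp add: \<phi>'_def)
  have out: "\<phi> n x = 0 \<and> \<phi>' n x = 0 \<and> T x = 0 \<and> J x = 0" if "x \<notin> K" for n x
  proof (cases "x < a")
    case True
    then show ?thesis
      using assms by (simp add: \<phi>_def \<phi>'_def T_def J_def U(3) smooth_step_eq_0 mle)
  next
    case False
    then have x: "x > b + h + 1" using that by (simp add: K_def)
    then have "1 \<le> m n * (x - a)" "1 \<le> m n * (x - a - h)" "1 \<le> m n * (x - b)" "1 \<le> m n * (x - b - h)"
      using assms by (auto intro!: mge)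
    then have "\<phi> n x = 0 \<and> \<phi>' n x = 0"
      by (simp add: \<phi>_def \<phi>'_def U(4)[of "m n * _"] smooth_step_eq_1) (simp add: algebra_simps)
    then show ?thesis using x assms by (simp add: T_def J_def)
  qed
  have test: "test_function (\<phi> n)" for n
  proof -
    have "closure {x. \<phi> n x \<noteq> 0} \<subseteq> K"
      by (intro closure_minimal) (use out in blast, simp add: K_def)
    then show ?thesis
      unfolding test_function_def using smooth
      by (metis K_def closed_closure compact_Icc compact_Int_closed inf.absorb_iff2)
  qed
  have weak_n: "(LINT x|lebesgue. \<phi>' n x *\<^sub>R F x) = - (LINT x|lebesgue. \<phi> n x *\<^sub>R G x)" for n
  proof -
    have "\<phi>' n x *\<^sub>R F x = deriv (\<phi> n) x *\<^sub>R f x" "\<phi> n x *\<^sub>R G x = \<phi> n x *\<^sub>R g x" for x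
      using out[of x n] by (auto simp: F_def G_def D indicator_def)
    then have "(\<lambda>x. \<phi>' n x *\<^sub>R F x) = (\<lambda>x. deriv (\<phi> n) x *\<^sub>R f x)"
      "(\<lambda>x. \<phi> n x *\<^sub>R G x) = (\<lambda>x. \<phi> n x *\<^sub>R g x)" by (blast intro: ext)+
    then show ?thesis
      using weak test unfolding has_weak_derivative_def by presburger
  qed
  have meas: "(\<lambda>x. \<phi>' n x *\<^sub>R F x) \<in> borel_measurable lebesgue"
       "(\<lambda>x. \<phi> n x *\<^sub>R G x) \<in> borel_measurable lebesgue" for n
    using smooth_continuous_on[OF smooth[of n]] smooth_continuous_on[OF smooth_deriv[OF smooth[of n]]] int
    by (auto intro!: measurable_continuous_scaleR simp: D)
  have J_meas: "J \<in> borel_measurable lebesgue"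
    unfolding J_def[abs_def] by (intro measurable_completion) simp
  have T_cont: "continuous_on UNIV T"
    unfolding T_def[abs_def] by (intro continuous_intros)
  have step_lim: "(\<lambda>n. smooth_step (m n * y)) \<longlonglongrightarrow> indicator {0<..} y" for y
  proof (cases "y > 0")
    case True
    have "\<forall>\<^sub>F n in sequentially. m n \<ge> 1 / y"
      using mlim by (simp add: filterlim_at_top)
    then have "\<forall>\<^sub>F n in sequentially. smooth_step (m n * y) = indicator {0<..} y"
      by eventually_elim (use True in \<open>simp add: field_simps smooth_step_eq_1\<close>)
    then show ?thesis by (rule tendsto_eventually)
  qed (simp add: smooth_step_eq_0 mle)
  have J_alt: "J x = indicator {0<..} (x - a) - indicator {0<..} (x - a - h)
     - indicator {0<..} (x - b) + indicator {0<..} (x - b - h)" for x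
    using assms by (auto simp: J_def indicator_def)
  have lim1: "(\<lambda>n. LINT x|lebesgue. \<phi>' n x *\<^sub>R F x) \<longlonglongrightarrow> (LINT x|lebesgue. J x *\<^sub>R F x)"
  proof (rule integral_dominated_convergence[where w = "\<lambda>x. 2 * norm (F x)"])
    have "\<bar>\<phi>' n x\<bar> \<le> 2" for n x
      using smooth_step_bounds[of "m n * (x - a)"] smooth_step_bounds[of "m n * (x - a - h)"]
        smooth_step_bounds[of "m n * (x - b)"] smooth_step_bounds[of "m n * (x - b - h)"]
      unfolding \<phi>'_def by linarith
    then show "AE x in lebesgue. norm (\<phi>' n x *\<^sub>R F x) \<le> 2 * norm (F x)" for n
      by (intro AE_I2) (auto intro!: mult_right_mono)
    show "AE x in lebesgue. (\<lambda>n. \<phi>' n x *\<^sub>R F x) \<longlonglongrightarrow> J x *\<^sub>R F x"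
      unfolding J_alt \<phi>'_def by (intro AE_I2 tendsto_intros step_lim)
  qed (use int meas J_meas in \<open>auto intro!: borel_measurable_scaleR\<close>)
  have lim2: "(\<lambda>n. LINT x|lebesgue. \<phi> n x *\<^sub>R G x) \<longlonglongrightarrow> (LINT x|lebesgue. T x *\<^sub>R G x)"
  \<comment> \<open>\<open>2 * h\<close> bounds the limit \<open>T\<close>, and each of the four
    ramps is off by at most \<open>inverse (m n)\<close>, hence by at most 1.\<close>
  proof (rule integral_dominated_convergence[where w = "\<lambda>x. (2 * h + 4) * norm (G x)"])
    have U': "\<bar>inverse (m n) * U (m n * y) - max 0 y\<bar> \<le> inverse (m n)" for n y
    proof -
      have "max 0 (m n * y) = m n * max 0 y" using m0[of n] by (auto simp: max_def zero_le_mult_iff)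
      then have "inverse (m n) * U (m n * y) - max 0 y = inverse (m n) * (U (m n * y) - max 0 (m n * y))"
        using m0[of n] by (simp add: field_simps)
      then show ?thesis using U(5)[of "m n * y"] m0[of n] by (simp add: abs_mult)
    qed
    have four: "\<bar>(p - q - r + s) - (p' - q' - r' + s')\<bar> \<le> 4 * e"
      if "\<bar>p - p'\<bar> \<le> e" "\<bar>q - q'\<bar> \<le> e" "\<bar>r - r'\<bar> \<le> e" "\<bar>s - s'\<bar> \<le> e" for p q r s p' q' r' s' e :: real
      using that by linarith
    have bd: "\<bar>\<phi> n x - T x\<bar> \<le> 4 * inverse (m n)" for n x
      using four[OF U'[of n "x - a"] U'[of n "x - a - h"] U'[of n "x - b"] U'[of n "x - b - h"]]
      by (simp add: \<phi>_def T_def distrib_left right_diff_distrib del: inverse_nonnegative_iff_nonnegative)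
    have "\<bar>T x\<bar> \<le> 2 * h" for x
      using assms by (auto simp: T_def max_def)
    moreover have "inverse (m n) \<le> 1" for n using m[of n] by (simp add: field_simps)
    ultimately have "\<bar>\<phi> n x\<bar> \<le> 2 * h + 4" for n x
      using bd[of n x] by (smt (verit, best))
    then show "AE x in lebesgue. norm (\<phi> n x *\<^sub>R G x) \<le> (2 * h + 4) * norm (G x)" for n
      by (intro AE_I2) (auto intro!: mult_right_mono)
    have "(\<lambda>n. 4 * inverse (m n)) \<longlonglongrightarrow> 4 * 0"
      by (intro tendsto_intros tendsto_inverse_0_at_top mlim)
    then have "(\<lambda>n. \<phi> n x - T x) \<longlonglongrightarrow> 0" for x
      by (intro Lim_null_comparison[of "\<lambda>n. \<phi> n x - T x" "\<lambda>n. 4 * inverse (m n)"] always_eventually)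
        (simp_all add: bd)
    then have "(\<lambda>n. \<phi> n x) \<longlonglongrightarrow> T x" for x
      by (rule LIM_zero_cancel)
    then show "AE x in lebesgue. (\<lambda>n. \<phi> n x *\<^sub>R G x) \<longlonglongrightarrow> T x *\<^sub>R G x"
      by (intro AE_I2 tendsto_intros)
  qed (use int meas T_cont in \<open>auto intro!: measurable_continuous_scaleR\<close>)
  have eq: "(LINT x|lebesgue. J x *\<^sub>R F x) = - (LINT x|lebesgue. T x *\<^sub>R G x)"
    by (rule LIMSEQ_unique[OF lim1[unfolded weak_n] tendsto_minus[OF lim2]])
  have Jf: "indicator {a<..a+h} x *\<^sub>R F x = indicator {a<..a+h} x *\<^sub>R f x"
     "indicator {b<..b+h} x *\<^sub>R F x = indicator {b<..b+h} x *\<^sub>R f x" for x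
    using assms by (auto simp: F_def K_def indicator_def)
  have "integrable lebesgue (\<lambda>x. indicator {a<..a+h} x *\<^sub>R F x)"
      "integrable lebesgue (\<lambda>x. indicator {b<..b+h} x *\<^sub>R F x)"
    by (rule integrable_scaleR_bounded[where B = 1, OF measurable_completion _ int(1)]; simp)+
  then have Jint: "(LINT x|lebesgue. J x *\<^sub>R F x) = integral {a..a+h} f - integral {b..b+h} f"
    unfolding J_def scaleR_left_diff_distrib Jf
    by (simp only: Bochner_Integration.integral_diff LINT_half_open[OF li(1)])
  have TG: "T x *\<^sub>R G x = T x *\<^sub>R g x" for x
    using out[of x] by (auto simp: G_def indicator_def)
  show ?thesis
    using eq unfolding Jint TG by (simp only: T_def)
qed

text \<open>The Lebesgue differentiation theorem for right-hand means, along the widths 1/(n +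
  1).\<close>

lemma lebesgue_points:
  fixes f :: "real \<Rightarrow> 'a::euclidean_space"
  assumes "locally_integrable f"
  obtains N where "negligible N" "\<And>x. x \<notin> N \<Longrightarrow>
    (\<lambda>n. real (Suc n) *\<^sub>R integral {x..x + inverse (real (Suc n))} f) \<longlonglongrightarrow> f x"
proof -
  define m where "m n = real (Suc n)" for n
  have m: "m n > 0" for n by (simp add: m_def)
  have mlim: "filterlim m at_top sequentially"
    unfolding m_def[abs_def] by (rule filterlim_real_Suc_at_top)
  obtain N where N: "negligible N" "\<And>x e. x \<notin> N \<Longrightarrow> 0 < e \<Longrightarrow> \<exists>d>0. \<forall>h. 0 < h \<and> h < d \<longrightarrow>
      norm (integral (cbox x (x + h *\<^sub>R One)) f /\<^sub>R h ^ DIM(real) - f x) < e"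
    by (rule integrable_ccontinuous_explicit[of f]) (use locally_integrable_integrable_on[OF assms] in auto)
  have "(\<lambda>n. m n *\<^sub>R integral {x..x + inverse (m n)} f) \<longlonglongrightarrow> f x" if "x \<notin> N" for x
  proof (rule LIMSEQ_I)
    fix e :: real assume "e > 0"
    have "\<exists>d>0. \<forall>h. 0 < h \<and> h < d \<longrightarrow> norm (integral {x..x + h} f /\<^sub>R h - f x) < e"
      using N(2)[OF that \<open>e > 0\<close>] by simp
    then obtain d where d: "d > 0"
      "\<And>h. 0 < h \<Longrightarrow> h < d \<Longrightarrow> norm (integral {x..x + h} f /\<^sub>R h - f x) < e"
      by blast
    have "\<forall>\<^sub>F n in sequentially. inverse (m n) < d"
      using order_tendstoD(2)[OF tendsto_inverse_0_at_top[OF mlim] d(1)] .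
    then obtain n0 where "\<And>n. n \<ge> n0 \<Longrightarrow> inverse (m n) < d"
      by (auto simp: eventually_sequentially)
    then show "\<exists>n0. \<forall>n\<ge>n0. norm (m n *\<^sub>R integral {x..x + inverse (m n)} f - f x) < e"
      using d(2)[of "inverse (m _)"] m by (intro exI[of _ n0]) auto
  qed
  then show ?thesis
    using that N(1) unfolding m_def by blast
qed

text \<open>Dividing the second difference identity by \<open>h\<close> and letting \<open>h \<rightarrow> 0\<close> at Lebesgue points of \<open>f\<close>
  avoids having to know that indefinite integrals are weakly differentiable.\<close>

proposition weak_derivative_integral_ae:
  fixes f g :: "real \<Rightarrow> 'a::euclidean_space"
  assumes weak: "has_weak_derivative f g"
  obtains N where "negligible N"
    "\<And>a b. a \<notin> N \<Longrightarrow> b \<notin> N \<Longrightarrow> a \<le> b \<Longrightarrow> f b - f a = integral {a..b} g"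
proof -
  have li: "locally_integrable f" "locally_integrable g"
    using weak by (auto simp: has_weak_derivative_def)
  define m where "m n = real (Suc n)" for n
  have m: "m n \<ge> 1" "m n > 0" for n by (simp_all add: m_def)
  have mlim: "filterlim m at_top sequentially"
    unfolding m_def[abs_def] by (rule filterlim_real_Suc_at_top)
  obtain N where N: "negligible N"
    and lim: "\<And>x. x \<notin> N \<Longrightarrow> (\<lambda>n. m n *\<^sub>R integral {x..x + inverse (m n)} f) \<longlonglongrightarrow> f x"
    unfolding m_def by (rule lebesgue_points[OF li(1)]) blast
  have "f b - f a = integral {a..b} g" if ab: "a \<notin> N" "b \<notin> N" "a \<le> b" for a b
  proof -
    \<comment> \<open>\<open>c n\<close> rises linearly from 0 to 1 on [0, 1/m]. The difference of
      its translates by \<open>a\<close> and \<open>b\<close> is the second difference for h = 1/m,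
      divided by h, and it tends to the indicator of \<open>{a<..b}\<close>.\<close>
    define c where "c n y = m n * (max 0 y - max 0 (y - inverse (m n)))" for n y
    define K where "K = {a..b + 1}"
    define G where "G x = indicator K x *\<^sub>R g x" for x
    define J where "J x = (indicator {0<..} (x - a) - indicator {0<..} (x - b) :: real)" for x
    have c_bounds: "0 \<le> c n y" "c n y \<le> 1" for n y
    proof -
      have "inverse (m n) > 0" using m(2)[of n] by simp
      then have "0 \<le> max 0 y - max 0 (y - inverse (m n))" "max 0 y - max 0 (y - inverse (m n)) \<le> inverse (m n)"
        by linarith+
      then show "0 \<le> c n y" "c n y \<le> 1"
        using m(2)[of n] mult_left_mono[of _ "inverse (m n)" "m n"] unfolding c_def by fastforce+
    qed
    have c_0: "c n y = 0" if "y \<le> 0" for n y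
    proof -
      have "inverse (m n) > 0" using m(2)[of n] by simp
      then have "max 0 y = 0" "max 0 (y - inverse (m n)) = 0" using that by linarith+
      then show ?thesis by (simp add: c_def)
    qed
    have c_1: "c n y = 1" if "y \<ge> inverse (m n)" for n y
    proof -
      have "y > 0" using that m(2)[of n] by (meson inverse_positive_iff_positive less_le_trans)
      then have "max 0 y = y" "max 0 (y - inverse (m n)) = y - inverse (m n)" using that by linarith+
      then show ?thesis using m(2)[of n] by (simp add: c_def)
    qed
    have inv1: "inverse (m n) \<le> 1" for n using m[of n] by (simp add: field_simps)
    have out: "c n (x - a) - c n (x - b) = 0 \<and> J x = 0" if "x \<notin> K" for n x
    proof (cases "x < a")
      case True
      then show ?thesis using ab by (simp add: c_0 J_def)
    next
      case False
      then have "x > b + 1" using that by (simp add: K_def)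
      then have "c n (x - a) = 1" "c n (x - b) = 1"
        using ab inv1[of n] by (auto intro!: c_1)
      then show ?thesis using ab \<open>x > b + 1\<close> by (simp add: J_def)
    qed
    have int: "integrable lebesgue G"
      unfolding G_def K_def using li by (auto intro: locally_integrable_indicator)
    have "(\<lambda>n. LINT x|lebesgue. (c n (x - a) - c n (x - b)) *\<^sub>R G x) \<longlonglongrightarrow> (LINT x|lebesgue. J x *\<^sub>R G x)"
    proof (rule integral_dominated_convergence[where w = "\<lambda>x. norm (G x)"])
      have "norm ((c n (x - a) - c n (x - b)) *\<^sub>R G x) \<le> 1 * norm (G x)" for n x
        using c_bounds[of n "x - a"] c_bounds[of n "x - b"]
        unfolding norm_scaleR by (intro mult_right_mono) auto
      then show "AE x in lebesgue. norm ((c n (x - a) - c n (x - b)) *\<^sub>R G x) \<le> norm (G x)" for n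
        by simp
      have "(\<lambda>n. c n y) \<longlonglongrightarrow> indicator {0<..} y" for y
      proof (cases "y > 0")
        case True
        have "\<forall>\<^sub>F n in sequentially. inverse (m n) < y"
          using order_tendstoD(2)[OF tendsto_inverse_0_at_top[OF mlim] True] .
        then have "\<forall>\<^sub>F n in sequentially. c n y = indicator {0<..} y"
          by eventually_elim (use True in \<open>simp add: c_1\<close>)
        then show ?thesis by (rule tendsto_eventually)
      qed (simp add: c_0)
      then show "AE x in lebesgue. (\<lambda>n. (c n (x - a) - c n (x - b)) *\<^sub>R G x) \<longlonglongrightarrow> J x *\<^sub>R G x"
        unfolding J_def by (intro AE_I2 tendsto_intros)
      have "continuous_on UNIV (\<lambda>x. c n (x - a) - c n (x - b))" for n
        unfolding c_def by (intro continuous_intros)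
      then show "(\<lambda>x. (c n (x - a) - c n (x - b)) *\<^sub>R G x) \<in> borel_measurable lebesgue" for n
        using int by (intro measurable_continuous_scaleR)
      have "J = indicator {a<..b}"
        using ab by (auto simp: J_def indicator_def)
      then have "J \<in> borel_measurable lebesgue"
        by (auto intro!: measurable_completion)
      then show "(\<lambda>x. J x *\<^sub>R G x) \<in> borel_measurable lebesgue"
        using int by (auto intro!: borel_measurable_scaleR)
    qed (use int in auto)
    \<comment> \<open>The same integrals, evaluated by the second difference identity: they are
      differences of means of \<open>f\<close> at \<open>a\<close> and at \<open>b\<close>, which
      converge at Lebesgue points.\<close>
    moreover have "(LINT x|lebesgue. (c n (x - a) - c n (x - b)) *\<^sub>R G x) =
       - (m n *\<^sub>R integral {a..a + inverse (m n)} f - m n *\<^sub>R integral {b..b + inverse (m n)} f)" for n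
    proof -
      have "(c n (x - a) - c n (x - b)) *\<^sub>R G x = m n *\<^sub>R
         ((max 0 (x - a) - max 0 (x - a - inverse (m n)) - max 0 (x - b) + max 0 (x - b - inverse (m n))) *\<^sub>R g x)" for x
      proof -
        have "(c n (x - a) - c n (x - b)) *\<^sub>R G x = (c n (x - a) - c n (x - b)) *\<^sub>R g x"
          using out[of x n] by (auto simp: G_def indicator_def)
        then show ?thesis by (simp add: c_def algebra_simps)
      qed
      then have "(LINT x|lebesgue. (c n (x - a) - c n (x - b)) *\<^sub>R G x) = m n *\<^sub>R (LINT x|lebesgue.
         (max 0 (x - a) - max 0 (x - a - inverse (m n)) - max 0 (x - b) + max 0 (x - b - inverse (m n))) *\<^sub>R g x)"
        by (simp only: integral_scaleR_right)
      then show ?thesis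
        using weak_derivative_second_difference[OF weak \<open>a \<le> b\<close>, of "inverse (m n)"] m(2)[of n]
        by (simp add: scaleR_diff_right[symmetric])
    qed
    moreover have "(\<lambda>n. - (m n *\<^sub>R integral {a..a + inverse (m n)} f - m n *\<^sub>R integral {b..b + inverse (m n)} f))
        \<longlonglongrightarrow> - (f a - f b)"
      by (intro tendsto_intros lim ab)
    moreover have "(LINT x|lebesgue. J x *\<^sub>R G x) = integral {a..b} g"
    proof -
      have "J x *\<^sub>R G x = indicator {a<..b} x *\<^sub>R g x" for x
        using ab by (auto simp: J_def G_def K_def indicator_def)
      then show ?thesis by (simp add: LINT_half_open[OF li(2)])
    qed
    ultimately have "integral {a..b} g = - (f a - f b)"
      by (simp add: LIMSEQ_unique)
    then show ?thesis by simp
  qed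
  then show ?thesis using that N by blast
qed

lemma negligible_complement_between:
  fixes a b :: real
  assumes "negligible N" "a < b"
  obtains x where "a < x" "x < b" "x \<notin> N"
proof -
  have "\<not> {a<..<b} \<subseteq> N"
    using assms open_not_negligible[of "{a<..<b}"] negligible_subset[of N "{a<..<b}"] by auto
  then show ?thesis using that by (auto simp: subset_iff)
qed

text \<open>Carries identities valid off a null set to every point by continuity. The explicit rate
  keeps the approximants within distance 1 of \<open>a\<close>.\<close>

lemma negligible_complement_seq:
  fixes a :: real
  assumes "negligible N"
  obtains s where "\<And>n. s n \<notin> N" "\<And>n. a < s n" "\<And>n. s n < a + inverse (real (Suc n))" "s \<longlonglongrightarrow> a"
proof -
  have "\<exists>x. x \<notin> N \<and> a < x \<and> x < a + inverse (real (Suc n))" for n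
    by (rule negligible_complement_between[OF assms, of a "a + inverse (real (Suc n))"]) auto
  then obtain s where s: "\<And>n. s n \<notin> N \<and> a < s n \<and> s n < a + inverse (real (Suc n))" by metis
  moreover have "s \<longlonglongrightarrow> a"
  proof (rule tendsto_sandwich[of "\<lambda>_. a" s _ "\<lambda>n. a + inverse (real (Suc n))"])
    show "(\<lambda>n. a + inverse (real (Suc n))) \<longlonglongrightarrow> a"
      by (rule LIMSEQ_inverse_real_of_nat_add)
    show "\<forall>\<^sub>F n in sequentially. s n \<le> a + inverse (real (Suc n))"
      by (rule always_eventually) (use s less_imp_le in blast)
    show "\<forall>\<^sub>F n in sequentially. a \<le> s n"
      by (rule always_eventually) (use s less_imp_le in blast)
  qed simp
  ultimately show ?thesis using that[of s] by simp
qed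

lemma continuous_zero_ae_imp_zero:
  fixes f :: "real \<Rightarrow> real"
  assumes "continuous_on UNIV f" "negligible N" "\<And>x. x \<notin> N \<Longrightarrow> f x = 0"
  shows "f x = 0"
proof -
  obtain s where s: "\<And>n. s n \<notin> N" "s \<longlonglongrightarrow> x"
    by (rule negligible_complement_seq[OF assms(2)]) blast
  have "(\<lambda>n. f (s n)) \<longlonglongrightarrow> f x"
    by (rule continuous_on_tendsto_compose[OF assms(1) s(2)]) auto
  then show ?thesis
    using s(1) assms(3) by (simp add: LIMSEQ_const_iff)
qed

lemma continuous_antiderivative:
  fixes k :: "real \<Rightarrow> 'a::euclidean_space"
  assumes "continuous_on UNIV k"
  obtains K where "\<And>x. (K has_vector_derivative k x) (at x)"
    "\<And>a b. a \<le> b \<Longrightarrow> integral {a..b} k = K b - K a"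
proof -
  have "isCont k x" for x
    using assms by (simp add: continuous_on_eq_continuous_at)
  then obtain K where K: "\<And>x. (K has_vector_derivative k x) (at x)"
    using einterval_antiderivative[of "-\<infinity>" \<infinity> k] by auto
  moreover have "integral {a..b} k = K b - K a" if "a \<le> b" for a b
    using fundamental_theorem_of_calculus[OF that, of K k] K has_vector_derivative_at_within
    by (blast intro: integral_unique)
  ultimately show ?thesis using that by blast
qed

text \<open>Both sides depend continuously on the end points, so \<open>a\<close> and
  \<open>b\<close> may be approached from the right through good points. All approximants of
  \<open>b\<close> stay below b + 1, where one primitive \<open>I\<close> controls
  everything.\<close>

corollary weak_derivative_integral:
  fixes f g :: "real \<Rightarrow> 'a::euclidean_space"
  assumes weak: "has_weak_derivative f g" and cont: "continuous_on UNIV f" and "a \<le> b"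
  shows "f b - f a = integral {a..b} g"
proof (cases "a = b")
  case False
  with \<open>a \<le> b\<close> have ab: "a < b" by simp
  obtain N where N: "negligible N"
    "\<And>a b. a \<notin> N \<Longrightarrow> b \<notin> N \<Longrightarrow> a \<le> b \<Longrightarrow> f b - f a = integral {a..b} g"
    by (rule weak_derivative_integral_ae[OF weak]) blast
  obtain s where s: "\<And>n. s n \<notin> N" "\<And>n. a < s n" "s \<longlonglongrightarrow> a"
    by (rule negligible_complement_seq[OF N(1)]) blast
  obtain t where t: "\<And>n. t n \<notin> N" "\<And>n. b < t n" "\<And>n. t n < b + inverse (real (Suc n))" "t \<longlonglongrightarrow> b"
    by (rule negligible_complement_seq[OF N(1)]) blast
  have int: "g integrable_on {c..d}" for c d
    using weak by (intro locally_integrable_integrable_on) (simp add: has_weak_derivative_def)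
  define I where "I x = integral {a..x} g" for x
  have "continuous_on {a..b+1} I"
    unfolding I_def by (rule indefinite_integral_continuous_1[OF int])
  moreover have "\<forall>\<^sub>F n in sequentially. s n \<in> {a..b+1}"
    using order_tendstoD(2)[OF s(3) ab] s(2) by (auto elim!: eventually_mono intro: less_imp_le)
  moreover have "inverse (real (Suc n)) \<le> 1" for n by (simp add: field_simps)
  then have "t n \<in> {a..b+1}" for n
    using t(2,3)[of n] ab by (smt (verit, best) atLeastAtMost_iff)
  ultimately have lim: "(\<lambda>n. I (t n) - I (s n)) \<longlonglongrightarrow> I b - I a"
    using ab s(3) t(4) by (intro tendsto_diff continuous_on_tendsto_compose[of _ I]) auto
  have ev: "\<forall>\<^sub>F n in sequentially. I (t n) - I (s n) = f (t n) - f (s n)"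
    using order_tendstoD(2)[OF s(3) ab]
  proof eventually_elim
    case (elim n)
    then have "s n \<le> t n" "a \<le> s n" using t(2)[of n] s(2)[of n] by auto
    then show ?case
      using N(2)[OF s(1) t(1), of n n] Henstock_Kurzweil_Integration.integral_combine[of a "s n" "t n" g] int
      by (simp add: I_def algebra_simps)
  qed
  have "(\<lambda>n. f (t n) - f (s n)) \<longlonglongrightarrow> f b - f a"
    using s(3) t(4) by (intro tendsto_diff continuous_on_tendsto_compose[OF cont]) auto
  then have "I b - I a = f b - f a"
    by (rule LIMSEQ_unique[OF Lim_transform_eventually[OF lim ev]])
  then show ?thesis by (simp add: I_def)
qed simp

subsection \<open>The first-order system\<close>

lemma norm_cross_le: "norm (x \<times> y) \<le> norm x * norm y" for x y :: "real^3"
proof (rule power2_le_imp_le)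
  show "(norm (x \<times> y))\<^sup>2 \<le> (norm x * norm y)\<^sup>2"
    using norm_cross_dot[of x y] zero_le_power2[of "x \<bullet> y"] by linarith
qed simp

lemma lower_order_components:
  "lower_order h v $ 1 = h" "lower_order h v $ 2 = - (v $ 2)" "lower_order h v $ 3 = - (v $ 3)"
  by (simp_all add: lower_order_def axis_def)

lemma norm_vec3_squared: "(norm v)\<^sup>2 = (v $ 1)\<^sup>2 + (v $ 2)\<^sup>2 + (v $ 3)\<^sup>2" for v :: "real^3"
  unfolding power2_norm_eq_inner by (simp add: inner_vec_def sum_3 power2_eq_square)

lemma norm_lower_order_diff: "norm (lower_order h v - lower_order h w) \<le> norm (v - w)"
  by (rule power2_le_imp_le)
    (simp_all add: norm_vec3_squared lower_order_components power2_commute)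

lemma norm_lower_order: "norm (lower_order h v) \<le> \<bar>h\<bar> + norm v"
proof -
  have "lower_order h 0 = h *\<^sub>R e1" by (simp add: lower_order_def)
  then show ?thesis
    using norm_lower_order_diff[of h v 0] norm_triangle_sub[of "lower_order h v" "lower_order h 0"] by simp
qed

text \<open>Gronwall in both directions: D exp(-K x) is nonincreasing and D exp(K x) is
  nondecreasing. To the right of \<open>x0\<close> the first gives \<open>D x \<le> 0\<close> and
  the second \<open>D x \<ge> 0\<close>; to the left they exchange roles.\<close>

lemma differential_inequality_zero:
  fixes D :: "real \<Rightarrow> real"
  assumes D: "\<And>x. DERIV D x :> D' x" and bound: "\<And>x. \<bar>D' x\<bar> \<le> K * D x" and "D x0 = 0"
  shows "D x = 0"
proof -
  have "DERIV (\<lambda>x. D x * exp (- K * x)) x :> (D' x - K * D x) * exp (- K * x)" for x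
    using D[of x] by (auto intro!: derivative_eq_intros simp: algebra_simps)
  moreover have "(D' x - K * D x) * exp (- K * x) \<le> 0" for x
    using bound[of x] by (intro mult_nonpos_nonneg) auto
  ultimately have 1: "D b * exp (- K * b) \<le> D a * exp (- K * a)" if "a \<le> b" for a b
    using that by (intro DERIV_nonpos_imp_nonincreasing[of a b "\<lambda>x. D x * exp (- K * x)"]) blast+
  have "DERIV (\<lambda>x. D x * exp (K * x)) x :> (D' x + K * D x) * exp (K * x)" for x
    using D[of x] by (auto intro!: derivative_eq_intros simp: algebra_simps)
  moreover have "(D' x + K * D x) * exp (K * x) \<ge> 0" for x
    using bound[of x] by (intro mult_nonneg_nonneg) auto
  ultimately have 2: "D a * exp (K * a) \<le> D b * exp (K * b)" if "a \<le> b" for a b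
    using that by (intro DERIV_nonneg_imp_nondecreasing[of a b "\<lambda>x. D x * exp (K * x)"]) blast+
  have exp_cancel: "0 \<le> D x * exp y \<Longrightarrow> 0 \<le> D x" "D x * exp y \<le> 0 \<Longrightarrow> D x \<le> 0" for y
    using exp_gt_zero[of y] by (simp_all add: zero_le_mult_iff mult_le_0_iff)
  show ?thesis
  proof (cases "x0 \<le> x")
    case True
    then show ?thesis using 1[of x0 x] 2[of x0 x] \<open>D x0 = 0\<close> exp_cancel
      by (metis antisym mult_zero_left)
  next
    case False
    then show ?thesis using 1[of x x0] 2[of x x0] \<open>D x0 = 0\<close> exp_cancel
      by (metis antisym linorder_le_cases mult_zero_left)
  qed
qed

text \<open>With x read as time, this is a spherical pendulum of unit mass in the force field -L(w),
  and \<open>V\<close> is its angular momentum w \<times> w'.\<close>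

definition stationary_flow :: "real \<Rightarrow> (real \<Rightarrow> real^3) \<Rightarrow> (real \<Rightarrow> real^3) \<Rightarrow> bool" where
  "stationary_flow h w V \<longleftrightarrow>
     (\<forall>x. (w has_vector_derivative V x \<times> w x) (at x)) \<and>
     (\<forall>x. (V has_vector_derivative lower_order h (w x) \<times> w x) (at x)) \<and>
     (\<forall>x. norm (w x) = 1 \<and> V x \<bullet> w x = 0)"

text \<open>The system is quadratic, but V \<times> w - U \<times> u = (V - U) \<times> w + U
  \<times> (w - u) involves, besides the differences, only unit vectors and the bounded
  \<open>U\<close>. So the squared distance \<open>D\<close> of the two states satisfies a linear
  differential inequality.\<close>

lemma stationary_flow_unique:
  assumes flow: "stationary_flow h w V" "stationary_flow h u U"
    and bound: "\<And>x. norm (U x) \<le> M"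
    and init: "w x0 = u x0" "V x0 = U x0"
  shows "w x = u x"
proof -
  define p where "p x = w x - u x" for x
  define q where "q x = V x - U x" for x
  define p' where "p' x = q x \<times> w x + U x \<times> p x" for x
  define q' where "q' x = (lower_order h (w x) - lower_order h (u x)) \<times> w x + lower_order h (u x) \<times> p x" for x
  define D where "D x = p x \<bullet> p x + q x \<bullet> q x" for x
  define B where "B = \<bar>h\<bar> + 1"
  have unit: "norm (w x) = 1" "norm (u x) = 1" for x
    using flow by (auto simp: stationary_flow_def)
  have M: "M \<ge> 0" using bound[of 0] norm_ge_zero order_trans by blast
  have dp: "(p has_vector_derivative p' x) (at x)" for x
  proof -
    have "((\<lambda>x. w x - u x) has_vector_derivative V x \<times> w x - U x \<times> u x) (at x)"
      using flow by (intro has_vector_derivative_diff) (auto simp: stationary_flow_def)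
    moreover have "V x \<times> w x - U x \<times> u x = p' x"
      by (simp add: p'_def p_def q_def Cross3.left_diff_distrib Cross3.right_diff_distrib)
    ultimately show ?thesis by (simp add: p_def[abs_def])
  qed
  have dq: "(q has_vector_derivative q' x) (at x)" for x
  proof -
    have "((\<lambda>x. V x - U x) has_vector_derivative lower_order h (w x) \<times> w x - lower_order h (u x) \<times> u x) (at x)"
      using flow by (intro has_vector_derivative_diff) (auto simp: stationary_flow_def)
    moreover have "lower_order h (w x) \<times> w x - lower_order h (u x) \<times> u x = q' x"
      by (simp add: q'_def p_def Cross3.left_diff_distrib Cross3.right_diff_distrib)
    ultimately show ?thesis by (simp add: q_def[abs_def])
  qed
  have dD: "DERIV D x :> 2 * (p x \<bullet> p' x) + 2 * (q x \<bullet> q' x)" for x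
  proof -
    have "(D has_vector_derivative (p x \<bullet> p' x + p' x \<bullet> p x) + (q x \<bullet> q' x + q' x \<bullet> q x)) (at x)"
      unfolding D_def[abs_def]
      by (intro has_vector_derivative_add bounded_bilinear.has_vector_derivative[OF bounded_bilinear_inner] dp dq)
    then show ?thesis
      by (simp add: has_real_derivative_iff_has_vector_derivative inner_commute)
  qed
  \<comment> \<open>With a = |p| and b = |q|, the bounds |p'| \<le> b + M a and |q'| \<le> a + B a
    give (2 + B) 2ab + 2M a^2, where 2ab and a^2 are at most \<open>D x\<close>. The factor 2 before
    \<open>2 + B\<close> is slack.\<close>
  have bd: "\<bar>2 * (p x \<bullet> p' x) + 2 * (q x \<bullet> q' x)\<bar> \<le> (2 * M + 2 * (2 + B)) * D x" for x
  proof -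
    let ?a = "norm (p x)" and ?b = "norm (q x)"
    have "norm (p' x) \<le> ?b + M * ?a"
    proof -
      have "norm (q x \<times> w x) \<le> ?b" using norm_cross_le[of "q x" "w x"] unit by simp
      moreover have "norm (U x \<times> p x) \<le> M * ?a"
        using norm_cross_le[of "U x" "p x"] mult_right_mono[OF bound[of x] norm_ge_zero[of "p x"]] by linarith
      ultimately show ?thesis
        unfolding p'_def using norm_triangle_ineq[of "q x \<times> w x" "U x \<times> p x"] by linarith
    qed
    then have 1: "\<bar>p x \<bullet> p' x\<bar> \<le> ?a * (?b + M * ?a)"
      using Cauchy_Schwarz_ineq2[of "p x" "p' x"] mult_left_mono[of "norm (p' x)" _ ?a] by fastforce
    have "norm (q' x) \<le> ?a + B * ?a"
    proof -
      have "norm ((lower_order h (w x) - lower_order h (u x)) \<times> w x) \<le> ?a"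
        using norm_cross_le[of "lower_order h (w x) - lower_order h (u x)" "w x"] unit
          norm_lower_order_diff[of h "w x" "u x"] by (simp add: p_def)
      moreover have "norm (lower_order h (u x)) \<le> B"
        using norm_lower_order[of h "u x"] unit by (simp add: B_def)
      then have "norm (lower_order h (u x) \<times> p x) \<le> B * ?a"
        using norm_cross_le[of "lower_order h (u x)" "p x"] mult_right_mono[OF _ norm_ge_zero[of "p x"]]
        by fastforce
      ultimately show ?thesis
        unfolding q'_def using norm_triangle_ineq[of "(lower_order h (w x) - lower_order h (u x)) \<times> w x"
          "lower_order h (u x) \<times> p x"] by linarith
    qed
    then have 2: "\<bar>q x \<bullet> q' x\<bar> \<le> ?b * (?a + B * ?a)"
      using Cauchy_Schwarz_ineq2[of "q x" "q' x"] mult_left_mono[of "norm (q' x)" _ ?b] by fastforce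
    have D: "D x = ?a\<^sup>2 + ?b\<^sup>2" by (simp add: D_def power2_norm_eq_inner)
    have ab: "2 * (?a * ?b) \<le> D x"
      using sum_squares_bound[of ?a ?b] by (simp add: D)
    have "2 * (?a * (?b + M * ?a)) + 2 * (?b * (?a + B * ?a)) = (2 + B) * (2 * (?a * ?b)) + 2 * (M * ?a\<^sup>2)"
      by (simp add: algebra_simps power2_eq_square)
    also have "\<dots> \<le> (2 + B) * D x + 2 * (M * D x)"
      using M ab by (intro add_mono mult_left_mono) (auto simp: D B_def)
    also have "\<dots> \<le> (2 * M + 2 * (2 + B)) * D x"
      by (simp add: algebra_simps D B_def)
    finally show ?thesis using 1 2 by linarith
  qed
  have "D x0 = 0" using init by (simp add: D_def p_def q_def)
  then have "D x = 0" by (rule differential_inequality_zero[OF dD bd])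
  then have "p x \<bullet> p x = 0"
    unfolding D_def by (meson add_nonneg_eq_0_iff inner_ge_zero)
  then show ?thesis by (simp add: p_def)
qed

section \<open>Conserved quantities\<close>

lemma integrable_nonneg_limit_at_bot_zero:
  fixes q :: "real \<Rightarrow> real"
  assumes "integrable lebesgue q" "\<And>x. 0 \<le> q x" "(q \<longlongrightarrow> l) at_bot"
  shows "l = 0"
proof (rule ccontr)
  assume "l \<noteq> 0"
  moreover have "l \<ge> 0"
    using assms(2) by (intro tendsto_lowerbound[OF assms(3)]) auto
  ultimately have l: "l > 0" by simp
  have "\<forall>\<^sub>F x in at_bot. l / 2 < q x"
    using order_tendstoD(1)[OF assms(3), of "l / 2"] l by simp
  then obtain A where A: "\<And>x. x \<le> A \<Longrightarrow> l / 2 < q x"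
    by (auto simp: eventually_at_bot_linorder)
  have bound: "real n * (l / 2) \<le> (LINT x|lebesgue. q x)" for n :: nat
  proof -
    have "(LINT x|lebesgue. (l / 2) * indicator {A - real n..A} x) \<le> (LINT x|lebesgue. q x)"
    proof (rule integral_mono)
      show "(l / 2) * indicator {A - real n..A} x \<le> q x" for x
        using A[of x] assms(2)[of x] by (auto simp: indicator_def)
      show "integrable lebesgue (\<lambda>x. (l / 2) * indicator {A - real n..A} x)"
        by (intro integrable_mult_right) (simp add: integrable_indicator_iff)
    qed (rule assms)
    then show ?thesis by (simp add: mult.commute)
  qed
  obtain n :: nat where "(LINT x|lebesgue. q x) < real n * (l / 2)"
    using reals_Archimedean3[of "l / 2"] l by (meson half_gt_zero)
  with bound[of n] show False by simp
qed

text \<open>For the pendulum these are the angular momentum about \<open>e1\<close>, conserved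
  because the force is invariant under rotations about that axis, and twice the energy, with
  potential h w1 - (w2^2 + w3^2)/2. Energy conservation makes |V|^2 converge at -\<infinity>,
  integrability makes the limit 0, and the constant first component squared lies below
  |V|^2.\<close>

lemma stationary_flow_invariants:
  assumes flow: "stationary_flow h w V"
    and int: "integrable lebesgue (\<lambda>x. (norm (V x))\<^sup>2)" and lim: "(w \<longlongrightarrow> e1) at_bot"
  shows "V x $ 1 = 0"
    and "(norm (V x))\<^sup>2 = (w x $ 2)\<^sup>2 + (w x $ 3)\<^sup>2 + 2 * h * (1 - w x $ 1)"
proof -
  have dw: "DERIV (\<lambda>x. w x $ i) x :> (V x \<times> w x) $ i" for i x
    using flow unfolding has_real_derivative_iff_has_vector_derivative
    by (intro bounded_linear.has_vector_derivative[OF bounded_linear_vec_nth]) (simp add: stationary_flow_def)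
  have dV: "DERIV (\<lambda>x. V x $ i) x :> (lower_order h (w x) \<times> w x) $ i" for i x
    using flow unfolding has_real_derivative_iff_has_vector_derivative
    by (intro bounded_linear.has_vector_derivative[OF bounded_linear_vec_nth]) (simp add: stationary_flow_def)
  define E where "E x = (V x $ 1)\<^sup>2 + (V x $ 2)\<^sup>2 + (V x $ 3)\<^sup>2 + 2 * h * (w x $ 1)
      - (w x $ 2)\<^sup>2 - (w x $ 3)\<^sup>2" for x
  have "DERIV E x :> 0" for x
    unfolding E_def[abs_def]
    by (rule derivative_eq_intros dw dV refl)+
      (simp add: cross_components lower_order_components algebra_simps)
  then have E: "E x = E y" for x y
    using DERIV_isconst_all by blast
  have V1: "V x $ 1 = V y $ 1" for x y
    using DERIV_isconst_all[of "\<lambda>x. V x $ 1"] dV[of 1]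
    by (simp add: cross_components lower_order_components)
  have lims: "((\<lambda>x. w x $ i) \<longlongrightarrow> e1 $ i) at_bot" for i
    by (intro tendsto_intros lim)
  have norm_V_E: "(norm (V x))\<^sup>2 = E x0 - 2 * h * (w x $ 1) + (w x $ 2)\<^sup>2 + (w x $ 3)\<^sup>2" for x x0
    using E[of x x0] by (simp add: norm_vec3_squared E_def)
  have "((\<lambda>x. E 0 - 2 * h * (w x $ 1) + (w x $ 2)\<^sup>2 + (w x $ 3)\<^sup>2) \<longlongrightarrow>
      E 0 - 2 * h * (e1 $ 1) + (e1 $ 2)\<^sup>2 + (e1 $ 3)\<^sup>2) at_bot"
    by (intro tendsto_intros lims)
  then have lim0: "((\<lambda>x. (norm (V x))\<^sup>2) \<longlongrightarrow> E 0 - 2 * h) at_bot"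
    unfolding norm_V_E[of _ 0] by (simp add: axis_def)
  have E0: "E 0 - 2 * h = 0"
    by (rule integrable_nonneg_limit_at_bot_zero[OF int _ lim0]) simp
  then show "(norm (V x))\<^sup>2 = (w x $ 2)\<^sup>2 + (w x $ 3)\<^sup>2 + 2 * h * (1 - w x $ 1)"
    unfolding norm_V_E[of _ 0] by (simp add: algebra_simps)
  have "(V x $ 1)\<^sup>2 \<le> 0"
  proof (rule tendsto_lowerbound[OF lim0[unfolded E0]])
    have "(V x $ 1)\<^sup>2 \<le> (norm (V y))\<^sup>2" for y
      using V1[of x y] by (simp add: norm_vec3_squared)
    then show "\<forall>\<^sub>F y in at_bot. (V x $ 1)\<^sup>2 \<le> (norm (V y))\<^sup>2" by simp
  qed simp
  then show "V x $ 1 = 0" by simp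
qed

section \<open>From distributional solutions to the first-order system\<close>

lemma continuous_imp_locally_integrable:
  fixes f :: "real \<Rightarrow> 'a::euclidean_space"
  assumes "continuous_on UNIV f"
  shows "locally_integrable f"
  unfolding locally_integrable_def
proof (intro allI impI)
  fix K :: "real set" assume K: "compact K"
  obtain a where a: "K \<subseteq> cbox (-a) a"
    by (rule bounded_subset_cbox_symmetric[OF compact_imp_bounded[OF K]])
  have "f absolutely_integrable_on cbox (-a) a"
    by (rule absolutely_integrable_continuous[OF continuous_on_subset[OF assms]]) simp
  then show "f absolutely_integrable_on K"
    by (rule set_integrable_subset[OF _ fmeasurableD[OF lmeasurable_compact[OF K]] a])
qed

lemma lower_order_continuous: "continuous_on S w \<Longrightarrow> continuous_on S (\<lambda>x. lower_order h (w x))"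
  unfolding lower_order_def by (intro continuous_intros)

lemma AE_lebesgue_negligible: "negligible N \<Longrightarrow> (\<And>x. x \<notin> N \<Longrightarrow> P x) \<Longrightarrow> AE x in lebesgue. P x"
  by (rule AE_I'[of N]) (auto simp: negligible_iff_null_sets)

lemma borel_measurable_cross:
  assumes "f \<in> borel_measurable M" "g \<in> borel_measurable M"
  shows "(\<lambda>x. f x \<times> g x) \<in> borel_measurable M"
  using borel_measurable_continuous_Pair[OF assms, of "(\<times>)"]
    continuous_on_cross[OF continuous_on_fst[OF continuous_on_id] continuous_on_snd[OF continuous_on_id]] by blast

lemma locally_integrable_unit_cross:
  assumes "continuous_on UNIV w" "\<And>x. norm (w x) = 1" "locally_integrable g"
  shows "locally_integrable (\<lambda>x. w x \<times> g x)"
  unfolding locally_integrable_def set_integrable_def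
proof (intro allI impI)
  fix K :: "real set" assume "compact K"
  then have K: "integrable lebesgue (\<lambda>x. indicator K x *\<^sub>R g x)"
    using assms(3) by (simp add: locally_integrable_def set_integrable_def)
  have "integrable lebesgue (\<lambda>x. w x \<times> (indicator K x *\<^sub>R g x))"
  proof (rule Bochner_Integration.integrable_bound[OF K])
    show "(\<lambda>x. w x \<times> (indicator K x *\<^sub>R g x)) \<in> borel_measurable lebesgue"
      by (intro borel_measurable_cross continuous_imp_measurable_lebesgue[OF assms(1)] borel_measurable_integrable[OF K])
    show "AE x in lebesgue. norm (w x \<times> (indicator K x *\<^sub>R g x)) \<le> norm (indicator K x *\<^sub>R g x)"
      by (rule AE_I2, rule order_trans[OF norm_cross_le]) (simp add: assms(2))
  qed
  then show "integrable lebesgue (\<lambda>x. indicator K x *\<^sub>R (w x \<times> g x))"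
    by (simp add: cross_mult_right)
qed

text \<open>For unit vectors (w(y) + w(x)) \<bullet> (w(y) - w(x)) = 0. Dividing by y - x and
  letting y tend to x at a Lebesgue point of \<open>g\<close> gives 2 w \<bullet> g = 0, without a
  product rule for weak derivatives.\<close>

lemma weak_derivative_orthogonal_unit:
  fixes w g :: "real \<Rightarrow> 'a::euclidean_space"
  assumes weak: "has_weak_derivative w g" and cont: "continuous_on UNIV w" and unit: "\<And>x. norm (w x) = 1"
  obtains N where "negligible N" "\<And>x. x \<notin> N \<Longrightarrow> w x \<bullet> g x = 0"
proof -
  have "locally_integrable g" using weak by (simp add: has_weak_derivative_def)
  then obtain N where N: "negligible N"
    and lim: "\<And>x. x \<notin> N \<Longrightarrow> (\<lambda>n. real (Suc n) *\<^sub>R integral {x..x + inverse (real (Suc n))} g) \<longlonglongrightarrow> g x"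
    by (rule lebesgue_points) blast
  have "w x \<bullet> g x = 0" if "x \<notin> N" for x
  proof -
    let ?y = "\<lambda>n. x + inverse (real (Suc n))"
    have "(\<lambda>n. (w (?y n) + w x) \<bullet> (real (Suc n) *\<^sub>R (w (?y n) - w x))) \<longlonglongrightarrow> (w x + w x) \<bullet> g x"
    proof (intro tendsto_intros)
      show "(\<lambda>n. w (?y n)) \<longlonglongrightarrow> w x"
        by (rule continuous_on_tendsto_compose[OF cont LIMSEQ_inverse_real_of_nat_add]) auto
      show "(\<lambda>n. real (Suc n) *\<^sub>R (w (?y n) - w x)) \<longlonglongrightarrow> g x"
        using lim[OF that] weak_derivative_integral[OF weak cont, of x "?y _"] by simp
    qed
    moreover have "(w (?y n) + w x) \<bullet> (real (Suc n) *\<^sub>R (w (?y n) - w x)) = 0" for n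
    proof -
      have "w y \<bullet> w y = 1" for y using unit by (simp add: dot_square_norm)
      then show ?thesis by (simp add: inner_add_left inner_diff_right inner_commute[of "w x" "w (?y n)"] del: of_nat_Suc)
    qed
    ultimately have "(w x + w x) \<bullet> g x = 0"
      by (simp only: LIMSEQ_const_iff)
    then show ?thesis by (simp add: inner_add_left)
  qed
  then show ?thesis using that N by blast
qed

proposition stationary_solution_imp_flow:
  assumes "stationary_solution h w"
  obtains V where "stationary_flow h w V" "integrable lebesgue (\<lambda>x. (norm (V x))\<^sup>2)"
proof -
  have "w \<in> energy_space" using assms by (simp add: stationary_solution_def)
  then have cont: "continuous_on UNIV w" and unit: "\<And>x. norm (w x) = 1"
    unfolding energy_space_def by (auto simp: image_subset_iff)
  obtain g where weak: "has_weak_derivative w g" and sq: "square_integrable g"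
    and eq: "\<And>\<phi>. test_function \<phi> \<Longrightarrow>
          - (LINT x|lebesgue. (deriv \<phi> x *\<^sub>R w x + \<phi> x *\<^sub>R g x) \<times> g x)
          + (LINT x|lebesgue. \<phi> x *\<^sub>R (w x \<times> lower_order h (w x))) = 0"
    using assms by (auto simp: stationary_solution_def)
  define f where "f x = w x \<times> g x" for x
  define p where "p x = lower_order h (w x) \<times> w x" for x
  have p_cont: "continuous_on UNIV p"
    unfolding p_def[abs_def] by (intro continuous_on_cross lower_order_continuous cont)
  have weak_f: "has_weak_derivative f p"
    unfolding has_weak_derivative_def
  proof (intro conjI allI impI)
    show "locally_integrable f"
      unfolding f_def[abs_def] using weak
      by (intro locally_integrable_unit_cross cont unit) (simp add: has_weak_derivative_def)
    show "locally_integrable p"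
      by (rule continuous_imp_locally_integrable[OF p_cont])
    fix \<phi> assume "test_function \<phi>"
    \<comment> \<open>As \<open>g x \<times> g x = 0\<close>, the transposed equation becomes
      exactly the weak derivative condition for \<open>f\<close>.\<close>
    have 1: "(deriv \<phi> x *\<^sub>R w x + \<phi> x *\<^sub>R g x) \<times> g x = deriv \<phi> x *\<^sub>R f x" for x
      by (simp add: cross_add_left cross_mult_left f_def)
    have 2: "\<phi> x *\<^sub>R (w x \<times> lower_order h (w x)) = - (\<phi> x *\<^sub>R p x)" for x
      unfolding p_def by (subst cross_skew) simp
    show "(LINT x|lebesgue. deriv \<phi> x *\<^sub>R f x) = - (LINT x|lebesgue. \<phi> x *\<^sub>R p x)"
    proof -
      have "- X + - Y = 0 \<Longrightarrow> X = - Y" for X Y :: "real^3"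
        by (metis add_eq_0_iff minus_minus)
      then show ?thesis
        using eq[OF \<open>test_function \<phi>\<close>] unfolding 1 2 integral_minus by blast
    qed
  qed
  obtain P where P: "\<And>x. (P has_vector_derivative p x) (at x)"
    "\<And>a b. a \<le> b \<Longrightarrow> integral {a..b} p = P b - P a"
    by (rule continuous_antiderivative[OF p_cont]) blast
  obtain N where N: "negligible N"
    "\<And>a b. a \<notin> N \<Longrightarrow> b \<notin> N \<Longrightarrow> a \<le> b \<Longrightarrow> f b - f a = integral {a..b} p"
    by (rule weak_derivative_integral_ae[OF weak_f]) blast
  obtain N' where N': "negligible N'" "\<And>x. x \<notin> N' \<Longrightarrow> w x \<bullet> g x = 0"
    by (rule weak_derivative_orthogonal_unit[OF weak cont unit]) blast
  obtain a where a: "a \<notin> N"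
    using negligible_complement_between[OF N(1), of 0 1] by auto
  \<comment> \<open>\<open>f\<close> is known only up to a null set. Its continuous representative
    is the primitive of \<open>p\<close>, normalised at a point \<open>a\<close> where the integral
    identity holds.\<close>
  define V where "V x = P x - P a + f a" for x
  have dV: "(V has_vector_derivative p x) (at x)" for x
    unfolding V_def[abs_def] using P(1)[of x] by (auto intro!: derivative_eq_intros)
  then have V_cont: "continuous_on UNIV V"
    by (meson continuous_at_imp_continuous_on has_vector_derivative_continuous)
  have fV: "f x = V x" if "x \<notin> N" for x
  proof (cases "a \<le> x")
    case True
    then show ?thesis using N(2)[OF a that] P(2)[of a x] by (simp add: V_def algebra_simps)
  next
    case False
    then show ?thesis using N(2)[OF that a] P(2)[of x a] by (simp add: V_def algebra_simps)
  qed
  \<comment> \<open>The double cross product w \<times> (w \<times> g) = (w \<bullet> g) w - (w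
    \<bullet> w) g recovers \<open>g\<close> from \<open>V\<close>. Being a continuous function
    almost everywhere, \<open>g\<close> then makes \<open>w\<close> continuously
    differentiable.\<close>
  have gV: "V x \<times> w x = g x" if "x \<notin> N" "x \<notin> N'" for x
  proof -
    have "w x \<bullet> w x = 1" using unit by (simp add: dot_square_norm)
    then have "w x \<times> f x = - g x"
      unfolding f_def Lagrange using N'(2)[OF that(2)] by simp
    then show ?thesis
      using fV[OF that(1)] by (metis add.inverse_inverse cross_skew)
  qed
  have NN: "negligible (N \<union> N')" using N(1) N'(1) by (rule negligible_Un)
  have Vw_cont: "continuous_on UNIV (\<lambda>x. V x \<times> w x)"
    by (intro continuous_on_cross V_cont cont)
  obtain W where W: "\<And>x. (W has_vector_derivative V x \<times> w x) (at x)"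
    "\<And>a b. a \<le> b \<Longrightarrow> integral {a..b} (\<lambda>x. V x \<times> w x) = W b - W a"
    by (rule continuous_antiderivative[OF Vw_cont]) blast
  have wW: "w b - w a = W b - W a" if "a \<le> b" for a b
    using weak_derivative_integral[OF weak cont that] W(2)[OF that]
      integral_spike[OF NN, of "{a..b}" "\<lambda>x. V x \<times> w x" g] gV by auto
  define c where "c = w 0 - W 0"
  have "w x = W x + c" for x
    using wW[of 0 x] wW[of x 0] by (cases "0 \<le> x") (auto simp: algebra_simps c_def)
  then have w_eq: "w = (\<lambda>x. W x + c)" by (rule ext)
  have dw: "(w has_vector_derivative V x \<times> w x) (at x)" for x
  proof -
    have "((\<lambda>x. W x + c) has_vector_derivative V x \<times> w x) (at x)"
      using has_vector_derivative_add[OF W(1) has_vector_derivative_const[of c]] by simp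
    then show ?thesis by (simp only: w_eq[symmetric])
  qed
  have "V x \<bullet> w x = 0" for x
  proof (rule continuous_zero_ae_imp_zero[of "\<lambda>x. V x \<bullet> w x", OF _ N(1)])
    show "continuous_on UNIV (\<lambda>x. V x \<bullet> w x)" by (intro continuous_intros V_cont cont)
    show "V x \<bullet> w x = 0" if "x \<notin> N" for x
      using fV[OF that] by (metis dot_cross_self(1) f_def inner_commute)
  qed
  then have "stationary_flow h w V"
    using dw dV unit by (simp add: stationary_flow_def p_def)
  moreover have "integrable lebesgue (\<lambda>x. (norm (V x))\<^sup>2)"
  proof (subst integrable_cong_AE)
    show "AE x in lebesgue. (norm (V x))\<^sup>2 = (norm (g x))\<^sup>2"
    proof (rule AE_lebesgue_negligible[OF NN])
      fix x assume "x \<notin> N \<union> N'"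
      then show "(norm (V x))\<^sup>2 = (norm (g x))\<^sup>2"
        using fV[of x] norm_cross[of "w x" "g x"] N'(2)[of x] unit[of x] by (simp add: f_def)
    qed
    show "(\<lambda>x. (norm (V x))\<^sup>2) \<in> borel_measurable lebesgue"
      by (intro continuous_imp_measurable_lebesgue continuous_intros V_cont)
  qed (use sq in \<open>auto simp: square_integrable_def\<close>)
  ultimately show ?thesis using that by blast
qed

subsection \<open>The explicit profile\<close>

text \<open>The function g of the overview. The amplitude comes from g'^2 = (1 + h) g^2 + h at 0:
  slope sqrt h at the zero of sinh if h > 0, and g^2 = -h/(1 + h) at the critical point of cosh if h
  < 0. The minus sign before cosh places \<theta> in (0, pi), the range of arccos.\<close>

definition profile :: "real \<Rightarrow> real \<Rightarrow> real" where
  "profile h x = sqrt \<bar>h\<bar> / sqrt (1 + h) *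
     (if h > 0 then sinh (sqrt (1 + h) * x) else - cosh (sqrt (1 + h) * x))"

definition profile_slope :: "real \<Rightarrow> real \<Rightarrow> real" where
  "profile_slope h x = sqrt \<bar>h\<bar> *
     (if h > 0 then cosh (sqrt (1 + h) * x) else - sinh (sqrt (1 + h) * x))"

text \<open>The values lie in (0, 2 pi), so no branch has to be chosen and \<open>e1\<close> is
  never attained.\<close>

definition angle :: "real \<Rightarrow> real \<Rightarrow> real" where
  "angle h x = pi + 2 * arctan (profile h x)"

definition angle_slope :: "real \<Rightarrow> real \<Rightarrow> real" where
  "angle_slope h x = 2 * profile_slope h x / (1 + (profile h x)\<^sup>2)"

lemma abs_sinh_ge: "\<bar>x\<bar> \<le> \<bar>sinh x\<bar>" for x :: real
proof -
  have "y \<le> sinh y" if "0 \<le> y" for y :: real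
  proof -
    have "sinh 0 - 0 \<le> sinh y - y"
    proof (rule DERIV_nonneg_imp_nondecreasing[OF that])
      show "\<exists>d. DERIV (\<lambda>y. sinh y - y) z :> d \<and> 0 \<le> d" for z :: real
        using cosh_real_ge_1[of z] by (intro exI[of _ "cosh z - 1"]) (auto intro!: derivative_eq_intros)
    qed
    then show ?thesis by simp
  qed
  from this[of x] this[of "- x"] show ?thesis by (cases "0 \<le> x") auto
qed

context
  fixes h :: real
  assumes h: "h > 0 \<or> h \<in> {-1<..<0}"
begin

lemma one_plus_pos: "1 + h > 0"
  using h by auto

lemma DERIV_profile: "DERIV (profile h) x :> profile_slope h x"
proof -
  obtain b where b: "sqrt (1 + h) = b" "b > 0" using one_plus_pos by simp
  then show ?thesis
    unfolding profile_def[abs_def] profile_slope_def b(1)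
    by (cases "h > 0") (auto intro!: derivative_eq_intros)
qed

lemma DERIV_profile_slope: "DERIV (profile_slope h) x :> (1 + h) * profile h x"
proof -
  obtain b where b: "sqrt (1 + h) = b" "1 + h = b * b" "b > 0"
    using one_plus_pos by (metis less_imp_le real_sqrt_gt_zero real_sqrt_mult_self abs_of_pos)
  show ?thesis
    unfolding profile_def profile_slope_def[abs_def] b(1) using b(3)
    by (cases "h > 0") (auto intro!: derivative_eq_intros simp: b(2))
qed

lemma profile_slope_squared: "(profile_slope h x)\<^sup>2 = (1 + h) * (profile h x)\<^sup>2 + h"
proof -
  have "(1 + h) * (profile h x)\<^sup>2 = \<bar>h\<bar> *
      (if h > 0 then (sinh (sqrt (1 + h) * x))\<^sup>2 else (cosh (sqrt (1 + h) * x))\<^sup>2)"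
    using one_plus_pos by (simp add: profile_def power_mult_distrib power_divide)
  moreover have "(profile_slope h x)\<^sup>2 = \<bar>h\<bar> *
      (if h > 0 then (cosh (sqrt (1 + h) * x))\<^sup>2 else (sinh (sqrt (1 + h) * x))\<^sup>2)"
    by (simp add: profile_slope_def power_mult_distrib)
  ultimately show ?thesis
    by (cases "h > 0") (simp_all add: cosh_square_eq algebra_simps)
qed

text \<open>Quadratic growth, far below the true exponential one, already bounds 1 - cos \<theta> =
  2/(1 + g^2) by the integrable function 2/(1 + |h| x^2).\<close>

lemma profile_squared_ge: "\<bar>h\<bar> * x\<^sup>2 \<le> (profile h x)\<^sup>2"
proof -
  have s: "(1 + h) * x\<^sup>2 \<le> (sinh (sqrt (1 + h) * x))\<^sup>2"
    using abs_sinh_ge[of "sqrt (1 + h) * x"] one_plus_pos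
    by (simp add: abs_le_square_iff power_mult_distrib)
  have "\<bar>h\<bar> * x\<^sup>2 = \<bar>h\<bar> / (1 + h) * ((1 + h) * x\<^sup>2)"
    using one_plus_pos by simp
  also have "\<dots> \<le> \<bar>h\<bar> / (1 + h) * (sinh (sqrt (1 + h) * x))\<^sup>2"
    using s one_plus_pos by (intro mult_left_mono) auto
  also have "\<dots> \<le> (profile h x)\<^sup>2"
    using one_plus_pos unfolding profile_def power_mult_distrib power_divide
    by (intro mult_mono) (auto simp: cosh_square_eq)
  finally show ?thesis .
qed

text \<open>The equation for (s, r) is a hyperbola and the sign condition selects one branch. The
  coordinate proportional to sinh takes every value and is inverted by arsinh; the other is then
  fixed up to sign by the equation, and by the branch.\<close>

lemma profile_surj:
  assumes "r\<^sup>2 = (1 + h) * s\<^sup>2 + h" "h > 0 \<Longrightarrow> r > 0" "h < 0 \<Longrightarrow> s < 0"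
  obtains x where "profile h x = s" "profile_slope h x = r"
proof (cases "h > 0")
  case True
  define x where "x = arsinh (s * sqrt (1 + h) / sqrt h) / sqrt (1 + h)"
  have "profile h x = s"
    using True one_plus_pos by (simp add: profile_def x_def)
  moreover from this have "(profile_slope h x)\<^sup>2 = r\<^sup>2"
    using assms(1) profile_slope_squared by simp
  moreover have "profile_slope h x > 0" using True by (simp add: profile_slope_def)
  ultimately show ?thesis
    using that assms(2)[OF True] by (metis less_imp_le power2_eq_imp_eq)
next
  case False
  then have neg: "h < 0" using h by auto
  define x where "x = arsinh (- r / sqrt (- h)) / sqrt (1 + h)"
  have r: "profile_slope h x = r"
    using neg one_plus_pos by (simp add: profile_slope_def x_def)
  then have "(1 + h) * s\<^sup>2 = (1 + h) * (profile h x)\<^sup>2"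
    using assms(1) profile_slope_squared[of x] by simp
  then have "(- profile h x)\<^sup>2 = (- s)\<^sup>2" using one_plus_pos by simp
  moreover have "profile h x < 0"
    using neg one_plus_pos by (simp add: profile_def mult_pos_pos)
  ultimately have "profile h x = s"
    using assms(3)[OF neg] by (smt (verit, best) power2_eq_imp_eq)
  then show ?thesis using that r by blast
qed

lemma cos_angle: "cos (angle h x) = ((profile h x)\<^sup>2 - 1) / (1 + (profile h x)\<^sup>2)"
  and sin_angle: "sin (angle h x) = - 2 * profile h x / (1 + (profile h x)\<^sup>2)"
proof -
  let ?g = "profile h x"
  have pos: "1 + ?g\<^sup>2 > 0" by (simp add: add_pos_nonneg)
  then have sq: "sqrt (1 + ?g\<^sup>2) * sqrt (1 + ?g\<^sup>2) = 1 + ?g\<^sup>2" by simp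
  show "cos (angle h x) = (?g\<^sup>2 - 1) / (1 + ?g\<^sup>2)"
    using pos by (simp add: angle_def cos_double cos_arctan sin_arctan power_divide diff_divide_distrib)
  show "sin (angle h x) = - 2 * ?g / (1 + ?g\<^sup>2)"
    unfolding angle_def using sq by (simp add: sin_double cos_arctan sin_arctan)
qed

lemma one_minus_cos_angle: "1 - cos (angle h x) = 2 / (1 + (profile h x)\<^sup>2)"
proof -
  have "1 + (profile h x)\<^sup>2 \<noteq> 0"
    by (metis add_pos_nonneg less_irrefl zero_le_power2 zero_less_one)
  then show ?thesis unfolding cos_angle by (simp add: field_simps)
qed

lemma DERIV_angle: "DERIV (angle h) x :> angle_slope h x"
  unfolding angle_def[abs_def] angle_slope_def
  by (auto intro!: derivative_eq_intros DERIV_profile simp: divide_inverse)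

lemma DERIV_angle_slope: "DERIV (angle_slope h) x :> sin (angle h x) * (cos (angle h x) + h)"
proof -
  let ?g = "profile h x" and ?r = "profile_slope h x"
  have pos: "1 + ?g\<^sup>2 > 0" by (simp add: add_pos_nonneg)
  have "DERIV (angle_slope h) x :>
    (2 * ((1 + h) * ?g) * (1 + ?g\<^sup>2) - 2 * ?r * (2 * ?g * ?r)) / ((1 + ?g\<^sup>2) * (1 + ?g\<^sup>2))"
    unfolding angle_slope_def[abs_def] using pos
    by (auto intro!: derivative_eq_intros DERIV_profile DERIV_profile_slope)
  \<comment> \<open>The first integral eliminates the slope, so that only a rational identity in g
    remains.\<close>
  also have "2 * ((1 + h) * ?g) * (1 + ?g\<^sup>2) - 2 * ?r * (2 * ?g * ?r) =
     2 * ((1 + h) * ?g) * (1 + ?g\<^sup>2) - 4 * ?g * ((1 + h) * ?g\<^sup>2 + h)"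
    unfolding profile_slope_squared[symmetric] by (simp add: power2_eq_square)
  also have "\<dots> = - 2 * ?g * ((?g\<^sup>2 - 1) + h * (1 + ?g\<^sup>2))"
    by (simp add: algebra_simps)
  also have "\<dots> / ((1 + ?g\<^sup>2) * (1 + ?g\<^sup>2)) = sin (angle h x) * (cos (angle h x) + h)"
  proof -
    have "(?g\<^sup>2 - 1) / (1 + ?g\<^sup>2) + h = ((?g\<^sup>2 - 1) + h * (1 + ?g\<^sup>2)) / (1 + ?g\<^sup>2)"
      using pos by (simp add: add_divide_distrib)
    then show ?thesis unfolding cos_angle sin_angle by (simp only: times_divide_times_eq)
  qed
  finally show ?thesis .
qed

lemma angle_slope_squared:
  "(angle_slope h x)\<^sup>2 = (sin (angle h x))\<^sup>2 + 2 * h * (1 - cos (angle h x))"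
proof -
  let ?g = "profile h x"
  have pos: "1 + ?g\<^sup>2 > 0" by (simp add: add_pos_nonneg)
  have "(angle_slope h x)\<^sup>2 = 4 * ((1 + h) * ?g\<^sup>2 + h) / (1 + ?g\<^sup>2)\<^sup>2"
    by (simp add: angle_slope_def power_divide power_mult_distrib profile_slope_squared)
  also have "4 * ((1 + h) * ?g\<^sup>2 + h) = 4 * ?g\<^sup>2 + 4 * h * (1 + ?g\<^sup>2)"
    by (simp add: algebra_simps)
  also have "\<dots> / (1 + ?g\<^sup>2)\<^sup>2 = (sin (angle h x))\<^sup>2 + 2 * h * (1 - cos (angle h x))"
    unfolding one_minus_cos_angle sin_angle using pos
    by (simp add: power_divide power_mult_distrib add_divide_distrib power2_eq_square[of "1 + _"])
  finally show ?thesis .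
qed

end

subsection \<open>Classification\<close>

lemma has_vector_derivative_componentwiseI:
  fixes f :: "real \<Rightarrow> real^'n"
  assumes "\<And>i. DERIV (\<lambda>x. f x $ i) x :> f' $ i"
  shows "(f has_vector_derivative f') (at x)"
  unfolding has_vector_derivative_def
proof (subst has_derivative_componentwise_within, intro ballI)
  fix b :: "real^'n" assume "b \<in> Basis"
  then obtain i where b: "b = axis i 1" by (metis axis_index)
  have "(\<lambda>x. x * (f' $ i)) = (*) (f' $ i)" by (simp add: fun_eq_iff)
  then show "((\<lambda>x. f x \<bullet> b) has_derivative (\<lambda>x. (x *\<^sub>R f') \<bullet> b)) (at x)"
    using assms[of i] by (simp add: b inner_axis has_field_derivative_def)
qed

lemma norm_vec3_eq_1: "(v $ 1)\<^sup>2 + (v $ 2)\<^sup>2 + (v $ 3)\<^sup>2 = 1 \<Longrightarrow> norm v = 1" for v :: "real^3"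
  by (rule power2_eq_imp_eq[of "norm v" 1]) (simp_all add: norm_vec3_squared)

lemma act_planar_components:
  "act \<phi> y (planar \<theta>) x $ 1 = cos (\<theta> (x - y))"
  "act \<phi> y (planar \<theta>) x $ 2 = cos \<phi> * sin (\<theta> (x - y))"
  "act \<phi> y (planar \<theta>) x $ 3 = sin \<phi> * sin (\<theta> (x - y))"
  by (simp_all add: act_def rotation_e1_def planar_def vector_3)

text \<open>The curve runs on the great circle through \<open>e1\<close> and (0, cos \<phi>, sin
  \<phi>). Its angular velocity is \<omega> times the unit normal e1 \<times> (0, cos \<phi>, sin
  \<phi>) = (0, -sin \<phi>, cos \<phi>), so the equation for \<open>V\<close> reduces to the scalar
  one for \<omega>.\<close>

lemma planar_stationary_flow:
  assumes D: "\<And>x. DERIV \<theta> x :> \<omega> x" "\<And>x. DERIV \<omega> x :> sin (\<theta> x) * (cos (\<theta> x) + h)"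
  shows "stationary_flow h (act \<phi> y (planar \<theta>)) (\<lambda>x. \<omega> (x - y) *\<^sub>R vector [0, - sin \<phi>, cos \<phi>])"
  unfolding stationary_flow_def
proof (intro conjI allI)
  let ?w = "act \<phi> y (planar \<theta>)" and ?V = "\<lambda>x. \<omega> (x - y) *\<^sub>R (vector [0, - sin \<phi>, cos \<phi>] :: real^3)"
  have pyth: "cos \<phi> * (cos \<phi> * z) + sin \<phi> * (sin \<phi> * z) = z" for z
    using sin_cos_squared_add[of \<phi>] by algebra
  have pyth': "(cos a)\<^sup>2 + ((cos \<phi> * sin a)\<^sup>2 + (sin \<phi> * sin a)\<^sup>2) = 1" for a
    by (simp add: power_mult_distrib distrib_right[symmetric])
  have D': "DERIV (\<lambda>x. \<theta> (x - y)) x :> \<omega> (x - y)"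
    "DERIV (\<lambda>x. \<omega> (x - y)) x :> sin (\<theta> (x - y)) * (cos (\<theta> (x - y)) + h)" for x
  proof -
    have "DERIV (\<lambda>x. x - y) x :> 1" by (auto intro!: derivative_eq_intros)
    from DERIV_chain2[OF D(1) this] DERIV_chain2[OF D(2) this]
    show "DERIV (\<lambda>x. \<theta> (x - y)) x :> \<omega> (x - y)"
      "DERIV (\<lambda>x. \<omega> (x - y)) x :> sin (\<theta> (x - y)) * (cos (\<theta> (x - y)) + h)"
      by simp_all
  qed
  fix x
  show "(?w has_vector_derivative ?V x \<times> ?w x) (at x)"
  proof (rule has_vector_derivative_componentwiseI)
    fix i :: 3
    show "DERIV (\<lambda>x. ?w x $ i) x :> (?V x \<times> ?w x) $ i"
      using exhaust_3[of i]
      by (elim disjE) (auto intro!: derivative_eq_intros D' simp: act_planar_components cross_components vector_3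
          algebra_simps pyth)
  qed
  show "(?V has_vector_derivative lower_order h (?w x) \<times> ?w x) (at x)"
  proof (rule has_vector_derivative_componentwiseI)
    fix i :: 3
    show "DERIV (\<lambda>x. ?V x $ i) x :> (lower_order h (?w x) \<times> ?w x) $ i"
      using exhaust_3[of i]
      by (elim disjE) (auto intro!: derivative_eq_intros D' simp: act_planar_components cross_components vector_3
          lower_order_components algebra_simps)
  qed
  show "norm (?w x) = 1"
    by (rule norm_vec3_eq_1) (simp add: act_planar_components pyth' add.assoc)
  show "?V x \<bullet> ?w x = 0"
    by (simp add: inner_vec_def sum_3 act_planar_components vector_3 algebra_simps)
qed

lemma polar_decomposition:
  fixes u v :: real
  assumes "r > 0" "u\<^sup>2 + v\<^sup>2 = r\<^sup>2"
  obtains \<phi> where "u = r * cos \<phi>" "v = r * sin \<phi>"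
proof -
  have "(u / r)\<^sup>2 + (v / r)\<^sup>2 = 1"
    using assms by (simp add: power_divide add_divide_distrib[symmetric])
  then obtain \<phi> where "u / r = cos \<phi>" "v / r = sin \<phi>"
    by (rule sincos_total_2pi) blast
  then show ?thesis using that[of \<phi>] assms(1) by (simp add: field_simps)
qed

text \<open>The stereographic projection from \<open>e\<^sub>1\<close> turns the rotated profiles into
  \<open>- g e\<^sup>i\<^sup>\<phi>\<close> with \<open>g\<close> solving \<open>g'' = (1 + h) g\<close>; this determines \<open>\<phi>\<close> and the position
  on the profile from the data at one point.\<close>

lemma profile_matches_data:
  fixes w V :: "real^3"
  assumes h: "h > 0 \<or> h \<in> {-1<..<0}"
    and unit: "norm w = 1" and orth: "V \<bullet> w = 0" and "w \<noteq> e1" and V1: "V $ 1 = 0"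
    and V: "(norm V)\<^sup>2 = (w $ 2)\<^sup>2 + (w $ 3)\<^sup>2 + 2 * h * (1 - w $ 1)"
  obtains \<phi> x where "w = act \<phi> 0 (planar (angle h)) x" "V = angle_slope h x *\<^sub>R vector [0, - sin \<phi>, cos \<phi>]"
proof -
  define r where "r = 1 - w $ 1"
  have w_sq: "(w $ 1)\<^sup>2 + (w $ 2)\<^sup>2 + (w $ 3)\<^sup>2 = 1"
    using unit norm_vec3_squared[of w] by simp
  have V_sq: "(V $ 2)\<^sup>2 + (V $ 3)\<^sup>2 = (w $ 2)\<^sup>2 + (w $ 3)\<^sup>2 + 2 * h * r"
    using V norm_vec3_squared[of V] V1 by (simp add: r_def)
  have orth': "V $ 2 * w $ 2 + V $ 3 * w $ 3 = 0"
    using orth V1 by (simp add: inner_vec_def sum_3)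
  have "r \<noteq> 0"
  proof
    assume "r = 0"
    then have "w $ 1 = 1" by (simp add: r_def)
    with w_sq have "w $ 2 = 0 \<and> w $ 3 = 0"
      by (simp add: add_nonneg_eq_0_iff)
    with \<open>w $ 1 = 1\<close> have "w = e1"
      by (auto simp: vec_eq_iff forall_3 axis_def)
    then show False using \<open>w \<noteq> e1\<close> by simp
  qed
  moreover have "(w $ 1)\<^sup>2 \<le> 1" using w_sq by (smt (verit, best) zero_le_power2)
  then have "w $ 1 \<le> 1" by (simp add: abs_square_le_1 abs_le_iff)
  ultimately have r: "r > 0" by (simp add: r_def)
  \<comment> \<open>On the profile 1 - cos \<theta> = 2/(1 + g^2), so with this value as
    \<open>r\<close> one has sin \<theta> = -r g and \<theta>' = r g'. Thus \<open>s\<close> and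
    \<open>t\<close> are the prospective values of g and g'.\<close>
  have "\<exists>\<phi> s t. (h > 0 \<longrightarrow> t > 0) \<and> (h < 0 \<longrightarrow> s < 0) \<and> w $ 2 = - r * s * cos \<phi> \<and> w $ 3 = - r * s * sin \<phi> \<and>
     V $ 2 = - r * t * sin \<phi> \<and> V $ 3 = r * t * cos \<phi>"
  proof (cases "h > 0")
    case True
    \<comment> \<open>For h > 0 the vector V never vanishes here, since |V|^2 \<ge> 2 h r, whereas
      (w2, w3) vanishes at -\<open>e1\<close>. So \<phi> is read off from V, and n > 0 gives t >
      0.\<close>
    define n where "n = sqrt ((V $ 2)\<^sup>2 + (V $ 3)\<^sup>2)"
    have "(V $ 2)\<^sup>2 + (V $ 3)\<^sup>2 > 0"
      unfolding V_sq using True r by (intro add_nonneg_pos) auto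
    then have n: "n > 0" "(V $ 3)\<^sup>2 + (- V $ 2)\<^sup>2 = n\<^sup>2"
      by (simp_all add: n_def)
    obtain \<phi> where \<phi>: "V $ 3 = n * cos \<phi>" "- V $ 2 = n * sin \<phi>"
      by (rule polar_decomposition[OF n]) 
    have "V $ 2 = - (n * sin \<phi>)" using \<phi>(2) by linarith
    then have "n * (w $ 3 * cos \<phi>) = n * (w $ 2 * sin \<phi>)"
      using orth' \<phi>(1) by (simp add: algebra_simps)
    then have eq: "w $ 3 * cos \<phi> = w $ 2 * sin \<phi>" using n by simp
    define s where "s = - (w $ 2 * cos \<phi> + w $ 3 * sin \<phi>) / r"
    have rs: "- r * s = w $ 2 * cos \<phi> + w $ 3 * sin \<phi>" using r by (simp add: s_def)
    have "(w $ 2 * cos \<phi> + w $ 3 * sin \<phi>) * cos \<phi> = w $ 2 * ((cos \<phi>)\<^sup>2 + (sin \<phi>)\<^sup>2)"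
      using eq by algebra
    moreover have "(w $ 2 * cos \<phi> + w $ 3 * sin \<phi>) * sin \<phi> = w $ 3 * ((cos \<phi>)\<^sup>2 + (sin \<phi>)\<^sup>2)"
      using eq by algebra
    ultimately have "w $ 2 = - r * s * cos \<phi>" "w $ 3 = - r * s * sin \<phi>"
      unfolding rs by simp_all
    then show ?thesis
      using True \<phi> r n by (intro exI[of _ \<phi>] exI[of _ s] exI[of _ "n / r"]) auto
  next
    case False
    then have neg: "h < 0" using h by auto
    \<comment> \<open>For h < 0 it is V that vanishes at the turning point, while w2^2 + w3^2 \<ge>
      -2 h r > 0. So \<phi> is read off from w, and its sign convention gives s < 0.\<close>
    define n where "n = sqrt ((w $ 2)\<^sup>2 + (w $ 3)\<^sup>2)"
    have "0 \<le> (w $ 2)\<^sup>2 + (w $ 3)\<^sup>2 + 2 * h * r"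
      unfolding V_sq[symmetric] by simp
    moreover have "2 * h * r < 0" using neg r by (simp add: mult_neg_pos)
    ultimately have "(w $ 2)\<^sup>2 + (w $ 3)\<^sup>2 > 0" by linarith
    then have n: "n > 0" "(w $ 2)\<^sup>2 + (w $ 3)\<^sup>2 = n\<^sup>2"
      by (simp_all add: n_def)
    obtain \<phi> where \<phi>: "w $ 2 = n * cos \<phi>" "w $ 3 = n * sin \<phi>"
      by (rule polar_decomposition[OF n])
    have "n * (V $ 2 * cos \<phi> + V $ 3 * sin \<phi>) = 0"
      using orth' \<phi> by (simp add: algebra_simps)
    then have eq: "V $ 2 * cos \<phi> = - (V $ 3 * sin \<phi>)" using n by simp
    define t where "t = (V $ 3 * cos \<phi> - V $ 2 * sin \<phi>) / r"
    have rt: "r * t = V $ 3 * cos \<phi> - V $ 2 * sin \<phi>" using r by (simp add: t_def)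
    have "(V $ 3 * cos \<phi> - V $ 2 * sin \<phi>) * cos \<phi> = V $ 3 * ((cos \<phi>)\<^sup>2 + (sin \<phi>)\<^sup>2)"
      using eq by algebra
    moreover have "(V $ 3 * cos \<phi> - V $ 2 * sin \<phi>) * sin \<phi> = - V $ 2 * ((cos \<phi>)\<^sup>2 + (sin \<phi>)\<^sup>2)"
      using eq by algebra
    ultimately have "V $ 3 = r * t * cos \<phi>" "V $ 2 = - r * t * sin \<phi>"
      unfolding mult_minus_left rt by simp_all
    then show ?thesis
      using neg \<phi> r n by (intro exI[of _ \<phi>] exI[of _ "- n / r"] exI[of _ t]) auto
  qed
  then obtain \<phi> s t where st: "h > 0 \<Longrightarrow> t > 0" "h < 0 \<Longrightarrow> s < 0"
    and w: "w $ 2 = - r * s * cos \<phi>" "w $ 3 = - r * s * sin \<phi>"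
    and Vt: "V $ 2 = - r * t * sin \<phi>" "V $ 3 = r * t * cos \<phi>"
    by blast
  have ww: "(w $ 2)\<^sup>2 + (w $ 3)\<^sup>2 = r\<^sup>2 * s\<^sup>2"
    unfolding w power_mult_distrib using sin_cos_squared_add[of \<phi>] by (simp flip: distrib_left)
  have VV: "(V $ 2)\<^sup>2 + (V $ 3)\<^sup>2 = r\<^sup>2 * t\<^sup>2"
    unfolding Vt power_mult_distrib using sin_cos_squared_add[of \<phi>] by (simp flip: distrib_left)
  have "(1 - r)\<^sup>2 + r\<^sup>2 * s\<^sup>2 = 1"
    using w_sq ww by (simp add: r_def)
  then have "r * (r * (1 + s\<^sup>2)) = r * 2"
    by (simp add: algebra_simps power2_eq_square)
  then have rs: "r * (1 + s\<^sup>2) = 2" using r by simp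
  \<comment> \<open>Writing the 2 in 2 h r as r (1 + s^2) makes the energy identity homogeneous in
    r, and dividing by r^2 leaves the hyperbola.\<close>
  have "r\<^sup>2 * t\<^sup>2 = r\<^sup>2 * s\<^sup>2 + h * r * (r * (1 + s\<^sup>2))"
    using V_sq unfolding ww VV rs by simp
  then have "r\<^sup>2 * t\<^sup>2 = r\<^sup>2 * ((1 + h) * s\<^sup>2 + h)"
    by (simp add: algebra_simps power2_eq_square)
  then have t: "t\<^sup>2 = (1 + h) * s\<^sup>2 + h" using r by simp
  obtain x where x: "profile h x = s" "profile_slope h x = t"
    by (rule profile_surj[OF h t st]) 
  have pos: "1 + s\<^sup>2 > 0" by (simp add: add_pos_nonneg)
  have r_eq: "r = 2 / (1 + s\<^sup>2)" using rs pos by (simp add: field_simps)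
  have "cos (angle h x) = w $ 1"
    using one_minus_cos_angle[OF h, of x] by (simp add: x r_def flip: r_eq)
  moreover have "sin (angle h x) = - r * s"
    unfolding sin_angle[OF h] x r_eq by simp
  moreover have "angle_slope h x = r * t"
    unfolding angle_slope_def x r_eq by simp
  ultimately show ?thesis
    using that[of \<phi> x] w Vt V1
    by (simp add: vec_eq_iff forall_3 act_planar_components vector_3)
qed

text \<open>The first integral bounds the square by 1 + 4 |h|, which is at most its own square; this
  crude bound suffices for \<open>stationary_flow_unique\<close>.\<close>

lemma angle_slope_bounded:
  assumes h: "h > 0 \<or> h \<in> {-1<..<0}"
  shows "\<bar>angle_slope h x\<bar> \<le> 1 + 4 * \<bar>h\<bar>"
proof -
  have "h * (1 - cos (angle h x)) \<le> \<bar>h\<bar> * 2"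
    using cos_ge_minus_one[of "angle h x"] cos_le_one[of "angle h x"]
    by (intro order_trans[OF _ mult_mono[of h "\<bar>h\<bar>" "1 - cos (angle h x)" 2]]) auto
  moreover have "(sin (angle h x))\<^sup>2 \<le> 1" by (simp add: abs_square_le_1)
  ultimately have "(angle_slope h x)\<^sup>2 \<le> 1 + 4 * \<bar>h\<bar>"
    unfolding angle_slope_squared[OF h] by linarith
  also have "\<dots> \<le> (1 + 4 * \<bar>h\<bar>)\<^sup>2" by (simp add: power2_eq_square algebra_simps)
  finally show ?thesis
    using abs_le_square_iff[of "angle_slope h x" "1 + 4 * \<bar>h\<bar>"] by simp
qed

proposition nontrivial_stationary_classification:
  assumes h: "h > 0 \<or> h \<in> {-1<..<0}" and w: "nontrivial_stationary h w"
  obtains \<phi> y where "w = act \<phi> y (planar (angle h))"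
proof -
  obtain V where flow: "stationary_flow h w V" and int: "integrable lebesgue (\<lambda>x. (norm (V x))\<^sup>2)"
    using w stationary_solution_imp_flow unfolding nontrivial_stationary_def by blast
  have lim: "(w \<longlongrightarrow> e1) at_bot" and nc: "\<not> w constant_on UNIV"
    using w by (auto simp: nontrivial_stationary_def)
  obtain x0 where x0: "w x0 \<noteq> e1"
    using nc by (auto simp: constant_on_def)
  have data: "norm (w x0) = 1" "V x0 \<bullet> w x0 = 0"
    using flow by (auto simp: stationary_flow_def)
  obtain \<phi> x where x: "w x0 = act \<phi> 0 (planar (angle h)) x"
      "V x0 = angle_slope h x *\<^sub>R vector [0, - sin \<phi>, cos \<phi>]"
    by (rule profile_matches_data[OF h data x0 stationary_flow_invariants[OF flow int lim]])
  \<comment> \<open>The profile has the required data at \<open>x\<close>; translating by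
    \<open>x0 - x\<close> moves them to \<open>x0\<close>.\<close>
  define U where "U z = angle_slope h (z - (x0 - x)) *\<^sub>R (vector [0, - sin \<phi>, cos \<phi>] :: real^3)" for z
  have flow': "stationary_flow h (act \<phi> (x0 - x) (planar (angle h))) U"
    unfolding U_def[abs_def] by (rule planar_stationary_flow[OF DERIV_angle[OF h] DERIV_angle_slope[OF h]])
  have "norm (vector [0, - sin \<phi>, cos \<phi>] :: real^3) = 1"
    by (rule norm_vec3_eq_1) simp
  then have bound: "norm (U z) \<le> 1 + 4 * \<bar>h\<bar>" for z
    using angle_slope_bounded[OF h] by (simp add: U_def)
  have "w z = act \<phi> (x0 - x) (planar (angle h)) z" for z
    by (rule stationary_flow_unique[OF flow flow' bound, of x0])
      (simp_all add: x U_def act_def)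
  then show ?thesis using that by blast
qed

subsection \<open>Existence and regularity\<close>

lemma test_function_support:
  assumes "test_function \<phi>"
  obtains a where "a > 0" "\<And>x. x \<notin> {-a<..<a} \<Longrightarrow> \<phi> x = 0" "\<And>x. x \<notin> {-a<..<a} \<Longrightarrow> deriv \<phi> x = 0"
proof -
  define C where "C = closure {x. \<phi> x \<noteq> 0}"
  have "compact C" using assms by (simp add: test_function_def C_def)
  then obtain b where b: "\<And>x. x \<in> C \<Longrightarrow> norm x \<le> b"
    using compact_imp_bounded bounded_iff by metis
  \<comment> \<open>The absolute value covers a negative \<open>b\<close>, possible when
    \<open>C\<close> is empty; the extra unit keeps the end points of the interval outside
    \<open>C\<close>.\<close>
  have notin: "x \<notin> C" if "x \<notin> {- (\<bar>b\<bar> + 1)<..<\<bar>b\<bar> + 1}" for x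
    using b[of x] that by auto
  have zero: "\<phi> x = 0" if "x \<notin> C" for x
    using that closure_subset[of "{x. \<phi> x \<noteq> 0}"] by (auto simp: C_def)
  have "deriv \<phi> x = 0" if "x \<notin> C" for x
  proof -
    have "\<forall>\<^sub>F y in nhds x. y \<in> - C"
      using that by (intro eventually_nhds_in_open) (auto simp: C_def)
    then have "\<forall>\<^sub>F y in nhds x. \<phi> y = 0"
      by eventually_elim (use zero in auto)
    then have "DERIV \<phi> x :> 0"
      by (subst DERIV_cong_ev[OF refl _ refl, where g = "\<lambda>_. 0"]) auto
    then show ?thesis by (rule DERIV_imp_deriv)
  qed
  with zero notin show ?thesis
    by (intro that[of "\<bar>b\<bar> + 1"]) auto
qed

lemma C1_has_weak_derivative:
  fixes f :: "real \<Rightarrow> 'a::euclidean_space"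
  assumes D: "\<And>x. (f has_vector_derivative f' x) (at x)" and cont: "continuous_on UNIV f'"
  shows "has_weak_derivative f f'"
  unfolding has_weak_derivative_def
proof (intro conjI allI impI)
  have f_cont: "continuous_on UNIV f"
    using D by (meson continuous_at_imp_continuous_on has_vector_derivative_continuous)
  show "locally_integrable f" "locally_integrable f'"
    using f_cont cont by (auto intro: continuous_imp_locally_integrable)
  fix \<phi> assume \<phi>: "test_function \<phi>"
  then have smooth: "smooth \<phi>" by (simp add: test_function_def)
  obtain a where a: "a > 0" "\<And>x. x \<notin> {-a<..<a} \<Longrightarrow> \<phi> x = 0" "\<And>x. x \<notin> {-a<..<a} \<Longrightarrow> deriv \<phi> x = 0"
    by (rule test_function_support[OF \<phi>]) blast
  have LINT: "(LINT x|lebesgue. q x *\<^sub>R k x) = integral {-a..a} (\<lambda>x. q x *\<^sub>R k x)"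
    if "continuous_on UNIV q" "continuous_on UNIV k" "\<And>x. x \<notin> {-a<..<a} \<Longrightarrow> q x = 0" for q and k :: "real \<Rightarrow> 'a"
  proof -
    have "continuous_on {-a..a} (\<lambda>x. q x *\<^sub>R k x)"
      using that(1,2) by (intro continuous_on_scaleR) (auto intro: continuous_on_subset)
    then have "(\<lambda>x. q x *\<^sub>R k x) absolutely_integrable_on {-a..a}"
      by (rule absolutely_integrable_continuous_real)
    from set_lebesgue_integral_eq_integral(2)[OF this]
    have int: "(LINT x|lebesgue. indicator {-a..a} x *\<^sub>R (q x *\<^sub>R k x)) = integral {-a..a} (\<lambda>x. q x *\<^sub>R k x)"
      by (simp only: set_lebesgue_integral_def)
    have ind: "indicator {-a..a} x *\<^sub>R (q x *\<^sub>R k x) = q x *\<^sub>R k x" for x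
      using that(3)[of x] by (cases "x \<in> {-a<..<a}") (auto simp: indicator_def)
    show ?thesis using int unfolding ind .
  qed
  have cont': "continuous_on UNIV \<phi>" "continuous_on UNIV (deriv \<phi>)"
    using smooth smooth_deriv smooth_continuous_on by blast+
  have "((\<lambda>x. \<phi> x *\<^sub>R f x) has_vector_derivative \<phi> x *\<^sub>R f' x + deriv \<phi> x *\<^sub>R f x) (at x)" for x
    by (rule has_vector_derivative_scaleR[OF smooth_DERIV[OF smooth] D])
  then have "((\<lambda>x. \<phi> x *\<^sub>R f' x + deriv \<phi> x *\<^sub>R f x) has_integral \<phi> a *\<^sub>R f a - \<phi> (-a) *\<^sub>R f (-a)) {-a..a}"
    using a(1) by (intro fundamental_theorem_of_calculus) (auto intro: has_vector_derivative_at_within)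
  then have "integral {-a..a} (\<lambda>x. \<phi> x *\<^sub>R f' x + deriv \<phi> x *\<^sub>R f x) = 0"
    using a(2)[of a] a(2)[of "-a"] by (simp add: integral_unique)
  moreover have "integral {-a..a} (\<lambda>x. \<phi> x *\<^sub>R f' x + deriv \<phi> x *\<^sub>R f x) =
      integral {-a..a} (\<lambda>x. \<phi> x *\<^sub>R f' x) + integral {-a..a} (\<lambda>x. deriv \<phi> x *\<^sub>R f x)"
    by (intro Henstock_Kurzweil_Integration.integral_add integrable_continuous_real continuous_on_scaleR)
      (auto intro: continuous_on_subset[OF cont] continuous_on_subset[OF f_cont]
        continuous_on_subset[OF cont'(1)] continuous_on_subset[OF cont'(2)])
  ultimately have "integral {-a..a} (\<lambda>x. deriv \<phi> x *\<^sub>R f x) = - integral {-a..a} (\<lambda>x. \<phi> x *\<^sub>R f' x)"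
    by (simp add: add_eq_0_iff)
  moreover have "(LINT x|lebesgue. deriv \<phi> x *\<^sub>R f x) = integral {-a..a} (\<lambda>x. deriv \<phi> x *\<^sub>R f x)"
    by (rule LINT[OF cont'(2) f_cont]) (rule a(3))
  moreover have "(LINT x|lebesgue. \<phi> x *\<^sub>R f' x) = integral {-a..a} (\<lambda>x. \<phi> x *\<^sub>R f' x)"
    by (rule LINT[OF cont'(1) cont]) (rule a(2))
  ultimately show "(LINT x|lebesgue. deriv \<phi> x *\<^sub>R f x) = - (LINT x|lebesgue. \<phi> x *\<^sub>R f' x)"
    by (simp only:)
qed

lemma stationary_flow_imp_solution:
  assumes flow: "stationary_flow h w V"
    and int: "integrable lebesgue (\<lambda>x. (w x $ 2)\<^sup>2)" "integrable lebesgue (\<lambda>x. (w x $ 3)\<^sup>2)"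
      "integrable lebesgue (\<lambda>x. (norm (V x))\<^sup>2)"
  shows "stationary_solution h w"
proof -
  define g where "g x = V x \<times> w x" for x
  define p where "p x = lower_order h (w x) \<times> w x" for x
  have dw: "(w has_vector_derivative g x) (at x)" and dV: "(V has_vector_derivative p x) (at x)"
    and unit: "norm (w x) = 1" and orth: "V x \<bullet> w x = 0" for x
    using flow by (auto simp: stationary_flow_def g_def p_def)
  have w_cont: "continuous_on UNIV w" and V_cont: "continuous_on UNIV V"
    using dw dV by (meson continuous_at_imp_continuous_on has_vector_derivative_continuous)+
  have g_cont: "continuous_on UNIV g" and p_cont: "continuous_on UNIV p"
    unfolding g_def[abs_def] p_def[abs_def]
    by (intro continuous_on_cross lower_order_continuous w_cont V_cont)+
  have weak: "has_weak_derivative w g" "has_weak_derivative V p"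
    by (rule C1_has_weak_derivative[OF dw g_cont] C1_has_weak_derivative[OF dV p_cont])+
  have "(norm (g x))\<^sup>2 = (norm (V x))\<^sup>2" for x
    unfolding g_def norm_cross orth unit by simp
  then have sq: "square_integrable g"
    using int(3) continuous_imp_measurable_lebesgue[OF g_cont] by (simp add: square_integrable_def)
  have comp: "square_integrable (\<lambda>x. w x $ i)" if "integrable lebesgue (\<lambda>x. (w x $ i)\<^sup>2)" for i
    using that unfolding square_integrable_def
    by (auto intro!: continuous_imp_measurable_lebesgue continuous_intros w_cont)
  have "w \<in> energy_space"
    unfolding energy_space_def using w_cont unit comp int weak(1) sq by (auto simp: image_subset_iff)
  moreover have "- (LINT x|lebesgue. (deriv \<phi> x *\<^sub>R w x + \<phi> x *\<^sub>R g x) \<times> g x)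
          + (LINT x|lebesgue. \<phi> x *\<^sub>R (w x \<times> lower_order h (w x))) = 0" if "test_function \<phi>" for \<phi>
  proof -
    \<comment> \<open>Since V is orthogonal to the unit vector w, w \<times> (V \<times> w) = V, and
      the tested equation is again the weak derivative condition for \<open>V\<close>.\<close>
    have "w x \<times> g x = V x" for x
    proof -
      have "w x \<bullet> w x = 1" using unit by (simp add: dot_square_norm)
      then show ?thesis unfolding g_def Lagrange using orth[of x] by (simp add: inner_commute)
    qed
    then have 1: "(deriv \<phi> x *\<^sub>R w x + \<phi> x *\<^sub>R g x) \<times> g x = deriv \<phi> x *\<^sub>R V x" for x
      by (simp add: cross_add_left cross_mult_left)
    have 2: "\<phi> x *\<^sub>R (w x \<times> lower_order h (w x)) = - (\<phi> x *\<^sub>R p x)" for x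
      unfolding p_def by (subst cross_skew) simp
    show ?thesis
      using weak(2) that unfolding 1 2 integral_minus has_weak_derivative_def by simp
  qed
  ultimately show ?thesis
    using weak(1) sq unfolding stationary_solution_def by blast
qed

section \<open>Integrability and Sobolev regularity\<close>

lemma integrable_inverse_quadratic:
  assumes "c > 0"
  shows "integrable lebesgue (\<lambda>x::real. inverse (1 + (c * x)\<^sup>2))"
proof -
  have pos: "1 + (c * x)\<^sup>2 > 0" for x by (simp add: add_pos_nonneg)
  have D: "DERIV (\<lambda>x. arctan (c * x) / c) x :> inverse (1 + (c * x)\<^sup>2)" for x
    using assms by (auto intro!: derivative_eq_intros)
  have cont: "continuous_on UNIV (\<lambda>x. inverse (1 + (c * x)\<^sup>2))"
    using pos by (intro continuous_intros) (auto simp: less_imp_neq[symmetric])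
  have top: "((\<lambda>x. arctan (c * x) / c) \<longlongrightarrow> (pi / 2) / c) at_top"
    using assms by (intro tendsto_intros filterlim_compose[OF tendsto_arctan_at_top])
      (auto intro: filterlim_tendsto_pos_mult_at_top[OF tendsto_const _ filterlim_ident])
  have bot: "((\<lambda>x. arctan (c * x) / c) \<longlongrightarrow> (- (pi / 2)) / c) at_bot"
    using assms by (intro tendsto_intros filterlim_compose[OF tendsto_arctan_at_bot])
      (auto intro: filterlim_tendsto_pos_mult_at_bot[OF tendsto_const _ filterlim_ident])
  have "set_integrable lborel (einterval (-\<infinity>) \<infinity>) (\<lambda>x. inverse (1 + (c * x)\<^sup>2))"
  proof (rule interval_integral_FTC_nonneg(1)[where F = "\<lambda>x. arctan (c * x) / c"])
    show "isCont (\<lambda>x. inverse (1 + (c * x)\<^sup>2)) x" for x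
      using cont by (simp add: continuous_on_eq_continuous_at)
    show "(((\<lambda>x. arctan (c * x) / c) \<circ> real_of_ereal) \<longlongrightarrow> (- (pi / 2)) / c) (at_right (-\<infinity>))"
      using bot by (simp add: ereal_tendsto_simps)
    show "(((\<lambda>x. arctan (c * x) / c) \<circ> real_of_ereal) \<longlongrightarrow> (pi / 2) / c) (at_left \<infinity>)"
      using top by (simp add: ereal_tendsto_simps)
  qed (use D pos in \<open>auto intro: less_imp_le\<close>)
  then have "integrable lborel (\<lambda>x. inverse (1 + (c * x)\<^sup>2))"
    by (simp add: set_integrable_def)
  then show ?thesis
    using cont by (subst integrable_completion) (auto intro: borel_measurable_continuous_onI)
qed

text \<open>These are the multipliers of square-integrable functions in
  \<open>derivs_hold_mult\<close>; continuity supplies measurability.\<close>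

definition bounded_continuous :: "(real \<Rightarrow> real) \<Rightarrow> bool" where
  "bounded_continuous f \<longleftrightarrow> continuous_on UNIV f \<and> (\<exists>B. \<forall>x. \<bar>f x\<bar> \<le> B)"

lemma bounded_continuousI: "continuous_on UNIV f \<Longrightarrow> (\<And>x. \<bar>f x\<bar> \<le> B) \<Longrightarrow> bounded_continuous f"
  by (auto simp: bounded_continuous_def)

lemma bounded_continuous_add:
  assumes "bounded_continuous f" "bounded_continuous g"
  shows "bounded_continuous (\<lambda>x. f x + g x)"
proof -
  obtain B C where "\<And>x. \<bar>f x\<bar> \<le> B" "\<And>x. \<bar>g x\<bar> \<le> C"
    using assms by (auto simp: bounded_continuous_def)
  then have "\<bar>f x + g x\<bar> \<le> B + C" for x
    by (meson abs_triangle_ineq add_mono order_trans)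
  then show ?thesis
    using assms by (intro bounded_continuousI continuous_on_add) (auto simp: bounded_continuous_def)
qed

lemma bounded_continuous_mult:
  assumes "bounded_continuous f" "bounded_continuous g"
  shows "bounded_continuous (\<lambda>x. f x * g x)"
proof -
  obtain B C where "\<And>x. \<bar>f x\<bar> \<le> B" "\<And>x. \<bar>g x\<bar> \<le> C"
    using assms by (auto simp: bounded_continuous_def)
  then have "\<bar>f x * g x\<bar> \<le> B * C" for x
    unfolding abs_mult by (intro mult_mono) (auto intro: order_trans[OF abs_ge_zero])
  then show ?thesis
    using assms by (intro bounded_continuousI continuous_on_mult) (auto simp: bounded_continuous_def)
qed

lemma square_integrable_add:
  fixes f g :: "real \<Rightarrow> real"
  assumes "square_integrable f" "square_integrable g"
  shows "square_integrable (\<lambda>x. f x + g x)"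
  unfolding square_integrable_def
proof
  show meas: "(\<lambda>x. f x + g x) \<in> borel_measurable lebesgue"
    using assms by (auto simp: square_integrable_def)
  have "integrable lebesgue (\<lambda>x. 2 * (f x)\<^sup>2 + 2 * (g x)\<^sup>2)"
    using assms by (intro Bochner_Integration.integrable_add integrable_mult_right) (auto simp: square_integrable_def)
  then show "integrable lebesgue (\<lambda>x. (norm (f x + g x))\<^sup>2)"
  proof (rule Bochner_Integration.integrable_bound)
    show "(\<lambda>x. (norm (f x + g x))\<^sup>2) \<in> borel_measurable lebesgue"
      using meas by measurable
    have "(f x + g x)\<^sup>2 \<le> 2 * (f x)\<^sup>2 + 2 * (g x)\<^sup>2" for x
      using sum_squares_bound[of "f x" "g x"] by (simp add: power2_sum)
    then show "AE x in lebesgue. norm ((norm (f x + g x))\<^sup>2) \<le> norm (2 * (f x)\<^sup>2 + 2 * (g x)\<^sup>2)"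
      by (intro AE_I2) (auto intro: order_trans[OF _ abs_ge_self])
  qed
qed

lemma square_integrable_bounded_mult:
  fixes f g :: "real \<Rightarrow> real"
  assumes "bounded_continuous f" "square_integrable g"
  shows "square_integrable (\<lambda>x. f x * g x)"
  unfolding square_integrable_def
proof
  have f: "f \<in> borel_measurable lebesgue"
    using assms(1) by (auto simp: bounded_continuous_def intro: continuous_imp_measurable_lebesgue)
  then show meas: "(\<lambda>x. f x * g x) \<in> borel_measurable lebesgue"
    using assms(2) by (auto simp: square_integrable_def)
  obtain B where B: "\<And>x. \<bar>f x\<bar> \<le> B" using assms(1) by (auto simp: bounded_continuous_def)
  have "(f x)\<^sup>2 \<le> B\<^sup>2" for x
    using B[of x] by (simp add: abs_le_square_iff[symmetric])
  then have "integrable lebesgue (\<lambda>x. (f x)\<^sup>2 *\<^sub>R (g x)\<^sup>2)"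
    using assms(2) f by (intro integrable_scaleR_bounded[where B = "B\<^sup>2"]) (auto simp: square_integrable_def)
  then show "integrable lebesgue (\<lambda>x. (norm (f x * g x))\<^sup>2)"
    by (simp add: power_mult_distrib)
qed

text \<open>Even level 0 of \<open>derivs_hold\<close> asks for differentiability, so every
  derivative taken is continuous and is a weak derivative by integration by parts.\<close>

lemma derivs_hold_square_integrable_imp_sobolev:
  "derivs_hold square_integrable k f \<Longrightarrow> sobolev k f"
proof (induction k arbitrary: f)
  case (Suc k)
  have "has_weak_derivative f (deriv f)"
  proof (rule C1_has_weak_derivative)
    show "(f has_vector_derivative deriv f x) (at x)" for x
      using derivs_hold_DERIV[OF Suc.prems] by (simp add: has_real_derivative_iff_has_vector_derivative)
    have "derivs_hold square_integrable k (deriv f)" using Suc.prems by simp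
    then show "continuous_on UNIV (deriv f)"
      by (rule DERIV_continuous_on[OF derivs_hold_DERIV])
  qed
  then show ?case using Suc by auto
qed simp

section \<open>The invariances and the effective field\<close>

lemma act_act: "act \<phi> y (act \<psi> z w) = act (\<phi> + \<psi>) (y + z) w"
  by (rule ext) (simp add: act_def rotation_e1_def vec_eq_iff forall_3 vector_3 cos_add sin_add algebra_simps)

lemma act_0_0: "act 0 0 w = w"
  by (rule ext) (simp add: act_def rotation_e1_def vec_eq_iff forall_3 vector_3)

lemma act_uminus_act: "act (- \<phi>) (- y) (act \<phi> y w) = w"
  by (simp add: act_act act_0_0)

lemma act_planar_tendsto_e1:
  assumes "((\<lambda>x. cos (\<theta> (x - y))) \<longlongrightarrow> 1) F" "((\<lambda>x. sin (\<theta> (x - y))) \<longlongrightarrow> 0) F"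
  shows "(act \<phi> y (planar \<theta>) \<longlongrightarrow> e1) F"
proof (rule vec_tendstoI)
  fix i :: 3
  show "((\<lambda>x. act \<phi> y (planar \<theta>) x $ i) \<longlongrightarrow> e1 $ i) F"
    using exhaust_3[of i] assms
    by (elim disjE) (auto simp: act_planar_components axis_def intro: tendsto_mult_right_zero)
qed

text \<open>Along the circle the second derivative is \<omega>' n - \<omega>^2 w with n the unit
  tangent. The equation for \<theta> cancels the tangential part of H; the radial part is
  -\<omega>^2 + h cos \<theta> - sin^2 \<theta>, and \<open>sq\<close> removes \<omega>^2.\<close>

lemma eff_field_planar:
  assumes D: "\<And>x. DERIV \<theta> x :> \<omega> x" "\<And>x. DERIV \<omega> x :> sin (\<theta> x) * (cos (\<theta> x) + h)"
    and sq: "(\<omega> x)\<^sup>2 = (sin (\<theta> x))\<^sup>2 + 2 * h * (1 - cos (\<theta> x))"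
  shows "eff_field h (planar \<theta>) x =
    (- 2 * (sin (\<theta> x))\<^sup>2 + 3 * h * cos (\<theta> x) - 2 * h) *\<^sub>R planar \<theta> x"
proof -
  have comps: "planar \<theta> x $ 1 = cos (\<theta> x)" "planar \<theta> x $ 2 = sin (\<theta> x)" "planar \<theta> x $ 3 = 0" for x
    by (simp_all add: planar_def vector_3)
  define p where "p x = (vector [- sin (\<theta> x) * \<omega> x, cos (\<theta> x) * \<omega> x, 0] :: real^3)" for x
  define q where "q x = (vector [- cos (\<theta> x) * (\<omega> x)\<^sup>2 - sin (\<theta> x) * (sin (\<theta> x) * (cos (\<theta> x) + h)),
    - sin (\<theta> x) * (\<omega> x)\<^sup>2 + cos (\<theta> x) * (sin (\<theta> x) * (cos (\<theta> x) + h)), 0] :: real^3)" for x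
  have "(planar \<theta> has_vector_derivative p x) (at x)" for x
  proof (rule has_vector_derivative_componentwiseI)
    fix i :: 3
    show "DERIV (\<lambda>x. planar \<theta> x $ i) x :> p x $ i"
      using exhaust_3[of i] by (elim disjE) (auto intro!: derivative_eq_intros D simp: comps p_def vector_3)
  qed
  then have 1: "(\<lambda>y. vector_derivative (planar \<theta>) (at y)) = p"
    by (intro ext vector_derivative_at)
  have "(p has_vector_derivative q x) (at x)"
  proof (rule has_vector_derivative_componentwiseI)
    fix i :: 3
    show "DERIV (\<lambda>x. p x $ i) x :> q x $ i"
      using exhaust_3[of i]
      by (elim disjE) (auto intro!: derivative_eq_intros D simp: p_def q_def vector_3 algebra_simps power2_eq_square)
  qed
  then have 2: "vector_derivative p (at x) = q x"
    by (rule vector_derivative_at)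
  have "q x $ 1 + h = (- 2 * (sin (\<theta> x))\<^sup>2 + 3 * h * cos (\<theta> x) - 2 * h) * cos (\<theta> x)"
    using sin_cos_squared_add[of "\<theta> x"] sq unfolding q_def vector_3 by algebra
  moreover have "q x $ 2 - sin (\<theta> x) = (- 2 * (sin (\<theta> x))\<^sup>2 + 3 * h * cos (\<theta> x) - 2 * h) * sin (\<theta> x)"
    using sin_cos_squared_add[of "\<theta> x"] sq unfolding q_def vector_3 by algebra
  ultimately show ?thesis
    unfolding eff_field_def 1 2
    by (simp add: vec_eq_iff forall_3 lower_order_components comps) (simp add: q_def vector_3)
qed

section \<open>Decay, regularity and limits of the profile\<close>

context
  fixes h :: real
  assumes h: "h > 0 \<or> h \<in> {-1<..<0}"
begin

lemma one_minus_cos_angle_integrable: "integrable lebesgue (\<lambda>x. 1 - cos (angle h x))"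
proof -
  have "sqrt \<bar>h\<bar> > 0" using h by auto
  then have "integrable lebesgue (\<lambda>x. 2 * inverse (1 + (sqrt \<bar>h\<bar> * x)\<^sup>2))"
    by (intro integrable_mult_right integrable_inverse_quadratic)
  then show ?thesis
  proof (rule Bochner_Integration.integrable_bound)
    have "continuous_on UNIV (\<lambda>x. 1 - cos (angle h x))"
      by (intro continuous_intros DERIV_continuous_on[OF DERIV_angle[OF h]])
    then show "(\<lambda>x. 1 - cos (angle h x)) \<in> borel_measurable lebesgue"
      by (rule continuous_imp_measurable_lebesgue)
    have "norm (1 - cos (angle h x)) \<le> norm (2 * inverse (1 + (sqrt \<bar>h\<bar> * x)\<^sup>2))" for x
    proof -
      have "inverse (1 + (profile h x)\<^sup>2) \<le> inverse (1 + (sqrt \<bar>h\<bar> * x)\<^sup>2)"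
        using profile_squared_ge[OF h, of x]
        by (intro le_imp_inverse_le) (auto simp: power_mult_distrib add_pos_nonneg)
      then show ?thesis
        unfolding one_minus_cos_angle[OF h] by (simp add: divide_inverse abs_mult add_nonneg_nonneg)
    qed
    then show "AE x in lebesgue. norm (1 - cos (angle h x)) \<le> norm (2 * inverse (1 + (sqrt \<bar>h\<bar> * x)\<^sup>2))"
      by simp
  qed
qed

lemma angle_continuous: "continuous_on S (angle h)"
  by (rule DERIV_continuous_on[OF has_field_derivative_at_within[OF DERIV_angle[OF h]]])

lemma angle_slope_continuous: "continuous_on S (angle_slope h)"
  by (rule DERIV_continuous_on[OF has_field_derivative_at_within[OF DERIV_angle_slope[OF h]]])

lemma square_integrable_sin_angle: "square_integrable (\<lambda>x. sin (angle h x))"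
  unfolding square_integrable_def
proof
  have cont: "continuous_on UNIV (\<lambda>x. sin (angle h x))"
    by (intro continuous_intros angle_continuous)
  then show "(\<lambda>x. sin (angle h x)) \<in> borel_measurable lebesgue"
    by (rule continuous_imp_measurable_lebesgue)
  \<comment> \<open>sin^2 = (1 + cos)(1 - cos), a bounded factor times an integrable one.\<close>
  have "integrable lebesgue (\<lambda>x. (1 + cos (angle h x)) *\<^sub>R (1 - cos (angle h x)))"
  proof (rule integrable_scaleR_bounded[where B = 2])
    show "\<bar>1 + cos (angle h x)\<bar> \<le> 2" for x
      using cos_ge_minus_one[of "angle h x"] cos_le_one[of "angle h x"] by linarith
    show "(\<lambda>x. 1 + cos (angle h x)) \<in> borel_measurable lebesgue"
      by (intro continuous_imp_measurable_lebesgue continuous_intros angle_continuous)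
  qed (rule one_minus_cos_angle_integrable)
  moreover have "(1 + cos a) *\<^sub>R (1 - cos a) = (norm (sin a))\<^sup>2" for a :: real
    using sin_cos_squared_add[of a] by (simp add: algebra_simps power2_eq_square)
  ultimately show "integrable lebesgue (\<lambda>x. (norm (sin (angle h x)))\<^sup>2)" by simp
qed

lemma square_integrable_angle_slope: "square_integrable (angle_slope h)"
  unfolding square_integrable_def
proof
  show "angle_slope h \<in> borel_measurable lebesgue"
    by (intro continuous_imp_measurable_lebesgue angle_slope_continuous)
  have "integrable lebesgue (\<lambda>x. (sin (angle h x))\<^sup>2 + 2 * h * (1 - cos (angle h x)))"
    using square_integrable_sin_angle
    by (intro Bochner_Integration.integrable_add integrable_mult_right one_minus_cos_angle_integrable)
      (simp add: square_integrable_def)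
  then show "integrable lebesgue (\<lambda>x. (norm (angle_slope h x))\<^sup>2)"
    by (simp add: angle_slope_squared[OF h])
qed

lemma bounded_continuous_trig_angle:
  "bounded_continuous (\<lambda>x. sin (angle h x))" "bounded_continuous (\<lambda>x. cos (angle h x))"
  "bounded_continuous (angle_slope h)"
proof -
  show "bounded_continuous (\<lambda>x. sin (angle h x))" "bounded_continuous (\<lambda>x. cos (angle h x))"
    by (rule bounded_continuousI[where B = 1], intro continuous_intros angle_continuous, simp)+
  show "bounded_continuous (angle_slope h)"
    by (rule bounded_continuousI[OF angle_slope_continuous angle_slope_bounded[OF h]])
qed

lemma bounded_continuous_const: "bounded_continuous (\<lambda>_. c)"
  by (rule bounded_continuousI[where B = "\<bar>c\<bar>"]) auto

text \<open>Bounded factors stand on the left and a square-integrable one on the right, and the sign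
  is a constant factor, so that the product rules for \<open>derivs_hold\<close> match.\<close>

lemma DERIV_trig_angle:
  "DERIV (\<lambda>x. sin (angle h x)) x :> cos (angle h x) * angle_slope h x"
  "DERIV (\<lambda>x. cos (angle h x)) x :> (- 1 * sin (angle h x)) * angle_slope h x"
  by (auto intro!: derivative_eq_intros DERIV_angle[OF h])

lemma DERIV_angle_slope': "DERIV (angle_slope h) x :> (cos (angle h x) + h) * sin (angle h x)"
  using DERIV_angle_slope[OF h] by (simp add: mult.commute)

text \<open>The derivatives of sin \<theta>, cos \<theta> and \<theta>' are polynomials in these
  three functions and h, which makes a simultaneous induction possible. Since cos \<theta> tends to
  1 at both ends, it is tracked only as bounded; the derivatives of the two L^2 functions each
  contain an L^2 factor.\<close>

lemma derivs_hold_trig_angle: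
  "derivs_hold bounded_continuous n (\<lambda>x. sin (angle h x)) \<and>
   derivs_hold bounded_continuous n (\<lambda>x. cos (angle h x)) \<and>
   derivs_hold bounded_continuous n (angle_slope h) \<and>
   derivs_hold square_integrable n (\<lambda>x. sin (angle h x)) \<and>
   derivs_hold square_integrable n (angle_slope h)"
proof (induction n)
  case 0
  show ?case
    by (intro conjI derivs_hold_0I[OF _ DERIV_trig_angle(1)] derivs_hold_0I[OF _ DERIV_trig_angle(2)]
        derivs_hold_0I[OF _ DERIV_angle_slope'] bounded_continuous_trig_angle
        square_integrable_sin_angle square_integrable_angle_slope)
next
  case (Suc n)
  have const: "derivs_hold bounded_continuous n (\<lambda>_. c)" for c
    by (rule derivs_hold_const) (rule bounded_continuous_const)
  note add = derivs_hold_add[of bounded_continuous, OF bounded_continuous_add]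
  note mult = derivs_hold_mult[of bounded_continuous bounded_continuous, OF bounded_continuous_add bounded_continuous_mult]
  note mult' = derivs_hold_mult[of square_integrable bounded_continuous, OF square_integrable_add square_integrable_bounded_mult]
  show ?case
    unfolding derivs_hold_Suc_iff[OF DERIV_trig_angle(1)] derivs_hold_Suc_iff[OF DERIV_trig_angle(2)]
      derivs_hold_Suc_iff[OF DERIV_angle_slope']
    by (intro conjI bounded_continuous_trig_angle square_integrable_sin_angle square_integrable_angle_slope
        mult mult' add const) (use Suc in blast)+
qed

lemma smooth_angle: "smooth (angle h)"
proof (rule smoothI[OF DERIV_angle[OF h]])
  have "derivs_hold P n f \<Longrightarrow> derivs_hold (\<lambda>_. True) n f" for P n f
    by (induction n arbitrary: f) auto
  then show "smooth (angle_slope h)"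
    using derivs_hold_trig_angle unfolding smooth_iff by blast
qed

lemma deriv_angle: "deriv (angle h) = angle_slope h"
  by (intro ext DERIV_imp_deriv DERIV_angle[OF h])

lemma sobolev_deriv_angle: "sobolev k (deriv (angle h))"
  unfolding deriv_angle
  using derivs_hold_trig_angle by (blast intro: derivs_hold_square_integrable_imp_sobolev)

text \<open>For h > 0 the profile runs from -\<infinity> to +\<infinity> and \<theta> makes a full
  turn; for h < 0 it tends to -\<infinity> at both ends and \<theta> returns to 0.\<close>

lemma angle_at_bot: "(angle h \<longlongrightarrow> 0) at_bot"
  and angle_at_top: "(angle h \<longlongrightarrow> (if h > 0 then 2 * pi else 0)) at_top"
proof -
  let ?b = "sqrt (1 + h)" and ?c = "sqrt \<bar>h\<bar> / sqrt (1 + h)"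
  have b: "?b > 0" and c: "?c > 0" using h by auto
  have bt: "filterlim (\<lambda>x. ?b * x) at_top at_top" and bb: "filterlim (\<lambda>x. ?b * x) at_bot at_bot"
    using b by (auto intro: filterlim_tendsto_pos_mult_at_top[OF tendsto_const _ filterlim_ident]
        filterlim_tendsto_pos_mult_at_bot[OF tendsto_const _ filterlim_ident])
  have lim: "((\<lambda>x. pi + 2 * arctan (g x)) \<longlongrightarrow> pi + 2 * (pi / 2)) F" if "filterlim g at_top F" for g :: "real \<Rightarrow> real" and F
    by (intro tendsto_intros filterlim_compose[OF tendsto_arctan_at_top that])
  have lim': "((\<lambda>x. pi + 2 * arctan (g x)) \<longlongrightarrow> pi + 2 * (- (pi / 2))) F" if "filterlim g at_bot F" for g :: "real \<Rightarrow> real" and F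
    by (intro tendsto_intros filterlim_compose[OF tendsto_arctan_at_bot that])
  show "(angle h \<longlongrightarrow> 0) at_bot"
  proof (cases "h > 0")
    case True
    have "filterlim (\<lambda>x. ?c * sinh (?b * x)) at_bot at_bot"
      by (rule filterlim_tendsto_pos_mult_at_bot[OF tendsto_const c filterlim_compose[OF sinh_real_at_bot bb]])
    from lim'[OF this] True show ?thesis by (simp add: angle_def[abs_def] profile_def)
  next
    case False
    have "filterlim (\<lambda>x. ?c * cosh (?b * x)) at_top at_bot"
      by (rule filterlim_tendsto_pos_mult_at_top[OF tendsto_const c filterlim_compose[OF cosh_real_at_bot bb]])
    then have "filterlim (\<lambda>x. - (?c * cosh (?b * x))) at_bot at_bot"
      by (simp add: filterlim_uminus_at_bot)
    from lim'[OF this] False show ?thesis by (simp add: angle_def[abs_def] profile_def)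
  qed
  show "(angle h \<longlongrightarrow> (if h > 0 then 2 * pi else 0)) at_top"
  proof (cases "h > 0")
    case True
    have "filterlim (\<lambda>x. ?c * sinh (?b * x)) at_top at_top"
      by (rule filterlim_tendsto_pos_mult_at_top[OF tendsto_const c filterlim_compose[OF sinh_real_at_top bt]])
    from lim[OF this] True show ?thesis by (simp add: angle_def[abs_def] profile_def)
  next
    case False
    have "filterlim (\<lambda>x. ?c * cosh (?b * x)) at_top at_top"
      by (rule filterlim_tendsto_pos_mult_at_top[OF tendsto_const c filterlim_compose[OF cosh_real_at_top bt]])
    then have "filterlim (\<lambda>x. - (?c * cosh (?b * x))) at_bot at_top"
      by (simp add: filterlim_uminus_at_bot)
    from lim'[OF this] False show ?thesis by (simp add: angle_def[abs_def] profile_def)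
  qed
qed

lemma planar_angle_tendsto_e1:
  "(act \<phi> y (planar (angle h)) \<longlongrightarrow> e1) at_bot" "(act \<phi> y (planar (angle h)) \<longlongrightarrow> e1) at_top"
proof -
  have "filterlim (\<lambda>x. x - y) at_bot at_bot"
    unfolding filterlim_at_bot
  proof
    show "\<forall>\<^sub>F x in at_bot. x - y \<le> Z" for Z
      using eventually_le_at_bot[of "Z + y"] by eventually_elim simp
  qed
  then have bot: "((\<lambda>x. angle h (x - y)) \<longlongrightarrow> 0) at_bot"
    by (rule filterlim_compose[OF angle_at_bot])
  have "filterlim (\<lambda>x. x - y) at_top at_top"
    unfolding filterlim_at_top
  proof
    show "\<forall>\<^sub>F x in at_top. Z \<le> x - y" for Z
      using eventually_ge_at_top[of "Z + y"] by eventually_elim simp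
  qed
  then have top: "((\<lambda>x. angle h (x - y)) \<longlongrightarrow> (if h > 0 then 2 * pi else 0)) at_top"
    by (rule filterlim_compose[OF angle_at_top])
  show "(act \<phi> y (planar (angle h)) \<longlongrightarrow> e1) at_bot"
    using tendsto_cos[OF bot] tendsto_sin[OF bot] by (intro act_planar_tendsto_e1) auto
  show "(act \<phi> y (planar (angle h)) \<longlongrightarrow> e1) at_top"
    using tendsto_cos[OF top] tendsto_sin[OF top] by (intro act_planar_tendsto_e1) (auto split: if_splits)
qed

lemma nontrivial_stationary_planar_angle: "nontrivial_stationary h (planar (angle h))"
proof -
  have flow: "stationary_flow h (planar (angle h)) (\<lambda>x. angle_slope h x *\<^sub>R vector [0, 0, 1])"
    using planar_stationary_flow[OF DERIV_angle[OF h] DERIV_angle_slope[OF h], of 0 0] by (simp add: act_0_0)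
  have "norm (vector [0, 0, 1] :: real^3) = 1" by (rule norm_vec3_eq_1) simp
  then have "stationary_solution h (planar (angle h))"
    using square_integrable_sin_angle square_integrable_angle_slope
    by (intro stationary_flow_imp_solution[OF flow])
      (simp_all add: square_integrable_def planar_def vector_3)
  moreover have lim: "(planar (angle h) \<longlongrightarrow> e1) at_bot"
    using planar_angle_tendsto_e1(1)[of 0 0] by (simp add: act_0_0)
  moreover have "\<not> planar (angle h) constant_on UNIV"
  proof
    assume "planar (angle h) constant_on UNIV"
    then obtain c where c: "\<And>x. planar (angle h) x = c" by (auto simp: constant_on_def)
    then have "planar (angle h) = (\<lambda>_. c)" by (rule ext)
    then have "c = e1" using lim by (simp add: tendsto_const_iff)
    then have "cos (angle h 0) = 1"
      using c[of 0] by (simp add: planar_def vec_eq_iff forall_3 vector_3 axis_def)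
    moreover have "1 - cos (angle h 0) > 0"
      unfolding one_minus_cos_angle[OF h] by (simp add: add_pos_nonneg)
    ultimately show False by simp
  qed
  ultimately show ?thesis by (simp add: nontrivial_stationary_def)
qed

end

theorem theorem1p4:
  fixes h0 :: real
  assumes "h0 > 0 \<or> h0 \<in> {-1<..<0}"
  shows
    "(\<exists>w. nontrivial_stationary h0 w) \<and>
     (\<forall>w w'. nontrivial_stationary h0 w \<and> nontrivial_stationary h0 w' \<longrightarrow>
        (\<exists>\<phi> y. w' = act \<phi> y w)) \<and>
     (h0 > 0 \<longrightarrow> (\<forall>w. nontrivial_stationary h0 w \<longrightarrow>
        (w \<longlongrightarrow> e1) at_top \<and>
        (\<exists>\<phi> y \<theta>. act \<phi> y w = planar \<theta> \<and> smooth \<theta> \<and>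
           \<theta> 0 = pi \<and> deriv \<theta> 0 = sqrt (4 * h0) \<and>
           (\<theta> \<longlongrightarrow> 0) at_bot \<and> (\<theta> \<longlongrightarrow> 2 * pi) at_top \<and>
           (\<forall>x. \<theta> (- x) - pi = - (\<theta> x - pi)) \<and>
           (\<forall>x. - deriv (deriv \<theta>) x + sin (\<theta> x) * cos (\<theta> x) + h0 * sin (\<theta> x) = 0) \<and>
           (\<forall>x. deriv \<theta> x = sqrt ((sin (\<theta> x))\<^sup>2 + 2 * h0 * (1 - cos (\<theta> x)))) \<and>
           square_integrable (\<lambda>x. sin (\<theta> x)) \<and>
           integrable lebesgue (\<lambda>x. 1 - cos (\<theta> x)) \<and>
           (\<forall>k\<ge>1. sobolev k (deriv \<theta>)) \<and>
           (\<forall>x. eff_field h0 (planar \<theta>) x =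
              (- 2 * (sin (\<theta> x))\<^sup>2 + 3 * h0 * cos (\<theta> x) - 2 * h0) *\<^sub>R planar \<theta> x)))) \<and>
     (h0 \<in> {-1<..<0} \<longrightarrow> (\<forall>w. nontrivial_stationary h0 w \<longrightarrow>
        (w \<longlongrightarrow> e1) at_top \<and>
        (\<exists>\<phi> y \<theta>. act \<phi> y w = planar \<theta> \<and> smooth \<theta> \<and>
           \<theta> 0 = arccos (- 1 - 2 * h0) \<and> deriv \<theta> 0 = 0 \<and>
           (\<theta> \<longlongrightarrow> 0) at_bot \<and> (\<theta> \<longlongrightarrow> 0) at_top \<and>
           (\<forall>x. \<theta> (- x) = \<theta> x) \<and>
           (\<forall>x. - deriv (deriv \<theta>) x + sin (\<theta> x) * cos (\<theta> x) + h0 * sin (\<theta> x) = 0) \<and>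
           (\<forall>x. deriv \<theta> x = - sgn x * sqrt ((sin (\<theta> x))\<^sup>2 + 2 * h0 * (1 - cos (\<theta> x)))) \<and>
           square_integrable (\<lambda>x. sin (\<theta> x)) \<and>
           integrable lebesgue (\<lambda>x. 1 - cos (\<theta> x)) \<and>
           (\<forall>k\<ge>1. sobolev k (deriv \<theta>)) \<and>
           (\<forall>x. eff_field h0 (planar \<theta>) x =
              (- 2 * (sin (\<theta> x))\<^sup>2 + 3 * h0 * cos (\<theta> x) - 2 * h0) *\<^sub>R planar \<theta> x))))"
proof -
  let ?\<theta> = "angle h0"
  note h = assms
  have orbit: "\<exists>\<phi> y. w = act \<phi> y (planar ?\<theta>)" if "nontrivial_stationary h0 w" for w
    using nontrivial_stationary_classification[OF h that] by metis
  have unique: "\<exists>\<phi> y. w' = act \<phi> y w" if "nontrivial_stationary h0 w" "nontrivial_stationary h0 w'" for w w'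
    using orbit[OF that(1)] orbit[OF that(2)] by (metis act_act act_uminus_act)
  have at_top: "(w \<longlongrightarrow> e1) at_top" and planar: "\<exists>\<phi> y. act \<phi> y w = planar ?\<theta>"
    if "nontrivial_stationary h0 w" for w
    using orbit[OF that] planar_angle_tendsto_e1(2)[OF h] act_uminus_act by metis+
  have ode: "- deriv (deriv ?\<theta>) x + sin (?\<theta> x) * cos (?\<theta> x) + h0 * sin (?\<theta> x) = 0" for x
    using DERIV_imp_deriv[OF DERIV_angle_slope[OF h]] by (simp add: deriv_angle[OF h] algebra_simps)
  have field: "eff_field h0 (planar ?\<theta>) x =
      (- 2 * (sin (?\<theta> x))\<^sup>2 + 3 * h0 * cos (?\<theta> x) - 2 * h0) *\<^sub>R planar ?\<theta> x" for x
    by (rule eff_field_planar[OF DERIV_angle[OF h] DERIV_angle_slope[OF h] angle_slope_squared[OF h]])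
  \<comment> \<open>The first integral leaves only the sign of \<theta>' open: it is that of cosh in
    the first case and that of -sinh in the second.\<close>
  have slope: "sqrt ((sin (?\<theta> x))\<^sup>2 + 2 * h0 * (1 - cos (?\<theta> x))) = \<bar>angle_slope h0 x\<bar>" for x
    by (simp flip: angle_slope_squared[OF h])
  have pos: "1 + (profile h0 x)\<^sup>2 > 0" for x by (simp add: add_pos_nonneg)
  note common = smooth_angle[OF h] angle_at_bot[OF h] ode square_integrable_sin_angle[OF h]
    one_minus_cos_angle_integrable[OF h] sobolev_deriv_angle[OF h] field
  have A: "?\<theta> 0 = pi \<and> deriv ?\<theta> 0 = sqrt (4 * h0) \<and> (?\<theta> \<longlongrightarrow> 2 * pi) at_top \<and>
      (\<forall>x. ?\<theta> (- x) - pi = - (?\<theta> x - pi)) \<and>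
      (\<forall>x. deriv ?\<theta> x = sqrt ((sin (?\<theta> x))\<^sup>2 + 2 * h0 * (1 - cos (?\<theta> x))))" if "h0 > 0"
  proof (intro conjI allI)
    show "?\<theta> 0 = pi" "?\<theta> (- x) - pi = - (?\<theta> x - pi)" for x
      using that by (simp_all add: angle_def profile_def arctan_minus)
    show "deriv ?\<theta> 0 = sqrt (4 * h0)"
      using that by (simp add: deriv_angle[OF h] angle_slope_def profile_slope_def profile_def real_sqrt_mult)
    show "(?\<theta> \<longlongrightarrow> 2 * pi) at_top" using angle_at_top[OF h] that by simp
    have "angle_slope h0 x \<ge> 0" for x
      using that pos[of x] by (simp add: angle_slope_def profile_slope_def)
    then show "deriv ?\<theta> x = sqrt ((sin (?\<theta> x))\<^sup>2 + 2 * h0 * (1 - cos (?\<theta> x)))" for x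
      unfolding slope deriv_angle[OF h] by simp
  qed
  have B: "?\<theta> 0 = arccos (- 1 - 2 * h0) \<and> deriv ?\<theta> 0 = 0 \<and> (?\<theta> \<longlongrightarrow> 0) at_top \<and>
      (\<forall>x. ?\<theta> (- x) = ?\<theta> x) \<and>
      (\<forall>x. deriv ?\<theta> x = - sgn x * sqrt ((sin (?\<theta> x))\<^sup>2 + 2 * h0 * (1 - cos (?\<theta> x))))" if "h0 \<in> {-1<..<0}"
  proof (intro conjI allI)
    show "?\<theta> (- x) = ?\<theta> x" for x
      using that by (simp add: angle_def profile_def)
    show "deriv ?\<theta> 0 = 0"
      using that by (simp add: deriv_angle[OF h] angle_slope_def profile_slope_def)
    show "(?\<theta> \<longlongrightarrow> 0) at_top" using angle_at_top[OF h] that by simp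
    \<comment> \<open>The value of g^2 gives cos \<theta>(0) = -1 - 2 h0, and the sign of g places
      \<theta>(0) in [0, pi], where arccos inverts cos.\<close>
    have g0: "(profile h0 0)\<^sup>2 = - h0 / (1 + h0)" "profile h0 0 \<le> 0"
      using that by (simp_all add: profile_def power_divide)
    have "cos (?\<theta> 0) = - 1 - 2 * h0"
      unfolding cos_angle[OF h] g0(1) using that by (simp add: field_simps)
    moreover have "0 \<le> ?\<theta> 0" "?\<theta> 0 \<le> pi"
      using g0(2) arctan_lbound[of "profile h0 0"] by (simp_all add: angle_def)
    ultimately show "?\<theta> 0 = arccos (- 1 - 2 * h0)"
      using arccos_cos by metis
    have "angle_slope h0 x = - sgn x * \<bar>angle_slope h0 x\<bar>" for x
    proof -
      have "sgn (sinh (sqrt (1 + h0) * x)) = sgn x"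
        using that by (cases x "0 :: real" rule: linorder_cases) (simp_all add: sgn_if zero_less_mult_iff)
      then have "sgn (angle_slope h0 x) = - sgn x"
        using that pos[of x]
        by (simp add: angle_slope_def profile_slope_def sgn_mult sgn_divide)
      then show ?thesis by (metis mult.commute sgn_mult_abs)
    qed
    then show "deriv ?\<theta> x = - sgn x * sqrt ((sin (?\<theta> x))\<^sup>2 + 2 * h0 * (1 - cos (?\<theta> x)))" for x
      unfolding slope deriv_angle[OF h] by blast
  qed
  show ?thesis
  proof (intro conjI impI allI)
    show "\<exists>w. nontrivial_stationary h0 w"
      using nontrivial_stationary_planar_angle[OF h] by blast
    show "\<exists>\<phi> y. w' = act \<phi> y w" if "nontrivial_stationary h0 w \<and> nontrivial_stationary h0 w'" for w w'
      using unique that by blast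
  next
    fix w assume "h0 > 0" and w: "nontrivial_stationary h0 w"
    show "(w \<longlongrightarrow> e1) at_top" by (rule at_top[OF w])
    obtain \<phi> y where "act \<phi> y w = planar ?\<theta>" using planar[OF w] by blast
    with A[OF \<open>h0 > 0\<close>] common show "\<exists>\<phi> y \<theta>. act \<phi> y w = planar \<theta> \<and> smooth \<theta> \<and>
           \<theta> 0 = pi \<and> deriv \<theta> 0 = sqrt (4 * h0) \<and>
           (\<theta> \<longlongrightarrow> 0) at_bot \<and> (\<theta> \<longlongrightarrow> 2 * pi) at_top \<and>
           (\<forall>x. \<theta> (- x) - pi = - (\<theta> x - pi)) \<and>
           (\<forall>x. - deriv (deriv \<theta>) x + sin (\<theta> x) * cos (\<theta> x) + h0 * sin (\<theta> x) = 0) \<and>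
           (\<forall>x. deriv \<theta> x = sqrt ((sin (\<theta> x))\<^sup>2 + 2 * h0 * (1 - cos (\<theta> x)))) \<and>
           square_integrable (\<lambda>x. sin (\<theta> x)) \<and>
           integrable lebesgue (\<lambda>x. 1 - cos (\<theta> x)) \<and>
           (\<forall>k\<ge>1. sobolev k (deriv \<theta>)) \<and>
           (\<forall>x. eff_field h0 (planar \<theta>) x =
              (- 2 * (sin (\<theta> x))\<^sup>2 + 3 * h0 * cos (\<theta> x) - 2 * h0) *\<^sub>R planar \<theta> x)"
      by (intro exI[of _ \<phi>] exI[of _ y] exI[of _ ?\<theta>] conjI allI impI) blast+
  next
    fix w assume "h0 \<in> {-1<..<0}" and w: "nontrivial_stationary h0 w"
    show "(w \<longlongrightarrow> e1) at_top" by (rule at_top[OF w])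
    obtain \<phi> y where "act \<phi> y w = planar ?\<theta>" using planar[OF w] by blast
    with B[OF \<open>h0 \<in> {-1<..<0}\<close>] common show "\<exists>\<phi> y \<theta>. act \<phi> y w = planar \<theta> \<and> smooth \<theta> \<and>
           \<theta> 0 = arccos (- 1 - 2 * h0) \<and> deriv \<theta> 0 = 0 \<and>
           (\<theta> \<longlongrightarrow> 0) at_bot \<and> (\<theta> \<longlongrightarrow> 0) at_top \<and>
           (\<forall>x. \<theta> (- x) = \<theta> x) \<and>
           (\<forall>x. - deriv (deriv \<theta>) x + sin (\<theta> x) * cos (\<theta> x) + h0 * sin (\<theta> x) = 0) \<and>
           (\<forall>x. deriv \<theta> x = - sgn x * sqrt ((sin (\<theta> x))\<^sup>2 + 2 * h0 * (1 - cos (\<theta> x)))) \<and>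
           square_integrable (\<lambda>x. sin (\<theta> x)) \<and>
           integrable lebesgue (\<lambda>x. 1 - cos (\<theta> x)) \<and>
           (\<forall>k\<ge>1. sobolev k (deriv \<theta>)) \<and>
           (\<forall>x. eff_field h0 (planar \<theta>) x =
              (- 2 * (sin (\<theta> x))\<^sup>2 + 3 * h0 * cos (\<theta> x) - 2 * h0) *\<^sub>R planar \<theta> x)"
      by (intro exI[of _ \<phi>] exI[of _ y] exI[of _ ?\<theta>] conjI allI impI) blast+
  qed
qed

end
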